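(* Fix $0<\delta<1/12$ and $i\in\{0,1\}$, and let $Y=Y(X)$ be real and satisfy $2\le Y\le X^{1/12-\delta}$. Then $$\lim_{T\to\infty}\limsup_{X\to\infty}\frac{C_T^{(i)}(X;Y)}{C^{(i)}(X;Y)}=0 .$$ Thus the distinct normalized integral Weierstrass models arising from solutions $P\in\mathcal P(Y)$ exhibit averaged non-escape of mass.
   Context: Forms and action: $V_{\mathbb R}$ is the space of real binary cubic forms $f(X,Y)=aX^3+bX^2Y+cXY^2+dY^3$, with $\mathrm{GL}_2(\mathbb R)$ acting by the twisted action $(g\cdot f)(X,Y)=\det(g)^{-1}f((X,Y)g)$, where $(X,Y)$ is a row vector. $\mathrm{Disc}(f)=b^2c^2-4ac^3-4b^3d-27a^2d^2+18abcd$. $V_{\mathbb R}^{(0)}$ (resp. $V_{\mathbb R}^{(1)}$) is the set of forms with $\mathrm{Disc}(f)>0$ (resp. $<0$); $V_{\mathbb Z}^{(i)}$ is the set of forms in $V_{\mathbb R}^{(i)}$ with integer coefficients $a,b,c,d$; $V_{\mathbb Z}^{(i),\mathrm{irr}}$ is the subset of forms irreducible over $\mathbb Q$. Fundamental domain: put $n(u)=\begin{pmatrix}1&0\\ u&1\end{pmatrix}$, $a(t)=\begin{pmatrix}t^{-1}&0\\0&t\end{pmatrix}$, $K=\mathrm{SO}_2(\mathbb R)$, $t_0=\sqrt[4]{3}/\sqrt2$; a scalar $\lambda>0$ stands for $\lambda I_2$. Gauss's usual fundamental domain for $\mathrm{GL}_2(\mathbb Z)\backslash\mathrm{GL}_2(\mathbb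 R)$ is $\mathcal F=\{n(u)a(t)k\lambda: u\in\nu(t),\ t\ge t_0,\ k\in K,\ \lambda>0\}$, where $\nu(t)\subset[-\frac12,\frac12]$ is a union of at most two intervals with $\nu(t)=[-\frac12,\frac12]$ for $t\ge1$ (explicitly, up to boundary, $\nu(t)=\{u\in[-\frac12,\frac12]:u^2+t^4\ge1\}$). For $T>t_0$, $\mathcal F_T=\{n(u)a(t)k\lambda\in\mathcal F:t>T\}$. Shape parameter: a real form $f=ax^3+bx^2y+cxy^2+dy^3$ of nonzero discriminant corresponds (Delone–Faddeev) to the cubic $\mathbb R$-algebra with basis $1,\omega,\theta$ and $\omega\theta=-ad$, $\omega^2=-ac+b\omega-a\theta$, $\theta^2=-bd+d\omega-c\theta$. If $\mathrm{Disc}(f)<0$ this algebra is $\mathbb R\oplus\mathbb C$; let $z_\omega,z_\theta$ be the images of $\omega,\theta$ in $(\mathbb R\oplus\mathbb C)/\mathbb R(1,1)\simeq\mathbb C$, with the complex embedding chosen so that $\Im(z_\theta/z_\omega)>0$, and $\tau_f=z_\theta/z_\omega$. If $\mathrm{Disc}(f)>0$, let $x^0=x-\mathrm{Tr}(x)/3$, $A_0=\mathrm{Tr}((\omega^0)^2)$, $B_0=\mathrm{Tr}(\omega^0\theta^0)$, $C_0=\mathrm{Tr}((\theta^0)^2)$, and $\tau_f=(B_0+\sqrt{-1}\sqrt{A_0C_0-B_0^2})/A_0$. For each $i\in\{0,1\}$ a base form $v^{(i)}\in V_{\mathbb R}^{(i)}$ with $\tau_{v^{(i)}}=\sqrt{-1}$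 is fixed. Normalized models: a normalized integral Weierstrass model is an equation $y^2=x^3+ux^2+Ax+B$ with $u\in\{0,1,2\}$, $A,B\in\mathbb Z$; models are counted as equations, not up to isomorphism. Let $f$ be an irreducible integral binary cubic form and $P\in\mathbb Z^2$ with $f(P)=1$ (then $P$ is primitive). Choose $M_P\in\mathrm{SL}_2(\mathbb Z)$ with first row $P$; then $M_P\cdot f$ is monic, $M_P\cdot f=X^3+bX^2Y+cXY^2+dY^3$. Let $u\in\{0,1,2\}$ with $u\equiv b\pmod 3$, $k=(u-b)/3$, $T_k=\begin{pmatrix}1&0\\ k&1\end{pmatrix}$, and $F_{f,P}=T_kM_P\cdot f=X^3+uX^2Y+AXY^2+BY^3$. Then $E_{f,P}$ is the model $y^2=x^3+ux^2+Ax+B$ (independent of the choice of $M_P$). Counts: fix constants $0<c_-<c_+$. Let $\mathcal P(Y)=\{(\alpha,\beta)\in\mathbb Z^2:\gcd(\alpha,\beta)=1,\ Y\le|\alpha|,|\beta|<2Y\}$. Let $\mathscr M^{(i)}(X;Y)$ be the multiset of pairs $(f,P)$ with $P\in\mathcal P(Y)$, $f\in\mathcal Fv^{(i)}\cap V_{\mathbb Z}^{(i),\mathrm{irr}}$, $f(P)=1$, $c_-X\le|\mathrm{Disc}(f)|<c_+X$, and $\mathscr M_T^{(i)}(X;Y)$ the submultiset of pairs with $f\in\mathcal F_Tv^{(i)}$. Set $C^{(i)}(X;Y)=\#\{E_{f,P}:(f,P)\in\mathscr M^{(i)}(X;Y)\}$ and $C_T^{(i)}(X;Y)=\#\{E_{f,P}:(f,P)\in\mathscr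 M_T^{(i)}(X;Y)\}$, both being cardinalities of sets of distinct models. *)

theory Defs
  imports "HOL-Analysis.Analysis" "HOL-Computational_Algebra.Polynomial"
begin

section \<open>Binary cubic forms\<close>

text \<open>The tuple \<open>(a, b, c, d)\<close> stands for \<open>a X^3 + b X^2 Y + c X Y^2 + d Y^3\<close>.\<close>

type_synonym 'a cubic_form = "'a \<times> 'a \<times> 'a \<times> 'a"

fun form_eval :: "'a::comm_ring_1 cubic_form \<Rightarrow> 'a \<Rightarrow> 'a \<Rightarrow> 'a" where
  "form_eval (a, b, c, d) x y = a * x^3 + b * x^2 * y + c * x * y^2 + d * y^3"

fun map_form :: "('a \<Rightarrow> 'b) \<Rightarrow> 'a cubic_form \<Rightarrow> 'b cubic_form" where
  "map_form h (a, b, c, d) = (h a, h b, h c, h d)"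

text \<open>The form as an element of \<open>R[X][Y]\<close>; the outer variable is \<open>Y\<close>.\<close>

fun form_poly :: "'a::comm_ring_1 cubic_form \<Rightarrow> 'a poly poly" where
  "form_poly (a, b, c, d) = [: [:0, 0, 0, a:], [:0, 0, b:], [:0, c:], [:d:] :]"

fun Disc :: "real cubic_form \<Rightarrow> real" where
  "Disc (a, b, c, d) =
     b^2 * c^2 - 4 * a * c^3 - 4 * b^3 * d - 27 * a^2 * d^2 + 18 * a * b * c * d"

text \<open>
  The twisted action \<open>(g \<cdot> f)(X, Y) = det(g)^{-1} f((X, Y) g)\<close>, expanded into coefficients;
  lemma \<open>form_eval_act\<close> below checks the expansion.
\<close>

fun act :: "real^2^2 \<Rightarrow> real cubic_form \<Rightarrow> real cubic_form" where
  "act g (a, b, c, d) =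
    (let p = g$1$1; q = g$1$2; r = g$2$1; s = g$2$2 in
     map_form (\<lambda>x. x / det g)
      (a * p^3 + b * p^2 * q + c * p * q^2 + d * q^3,
       3 * a * p^2 * r + b * (p^2 * s + 2 * p * q * r) + c * (2 * p * q * s + q^2 * r) + 3 * d * q^2 * s,
       3 * a * p * r^2 + b * (2 * p * r * s + q * r^2) + c * (p * s^2 + 2 * q * r * s) + 3 * d * q * s^2,
       a * r^3 + b * r^2 * s + c * r * s^2 + d * s^3))"

lemma form_eval_act:
  "form_eval (act g f) x y =
     inverse (det g) * (let w = (vector [x, y] :: real^2) v* g in form_eval f (w$1) (w$2))"
proof -
  obtain a b c d where f: "f = (a, b, c, d)" by (cases f)
  define p q r s where pqrs: "p = g$1$1" "q = g$1$2" "r = g$2$1" "s = g$2$2"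
  have w: "((vector [x, y] :: real^2) v* g)$1 = p * x + r * y"
    "((vector [x, y] :: real^2) v* g)$2 = q * x + s * y"
    by (simp_all add: vector_matrix_mult_def sum_2 vector_2 pqrs mult.commute)
  show ?thesis
    unfolding f act.simps Let_def w pqrs[symmetric] map_form.simps form_eval.simps divide_inverse
    by algebra
qed

lemma form_eqI:
  fixes f g :: "real cubic_form"
  assumes "\<And>x y. form_eval f x y = form_eval g x y"
  shows "f = g"
proof -
  obtain a b c d where f: "f = (a, b, c, d)" by (cases f)
  obtain a' b' c' d' where g: "g = (a', b', c', d')" by (cases g)
  show ?thesis
    using assms[of 1 0] assms[of 0 1] assms[of 1 1] assms[of 1 "- 1"] by (simp add: f g)
qed

lemma act_mult: "act (g ** h) f = act g (act h f)"
proof (rule form_eqI)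
  have vec: "(vector [z$1, z$2] :: real^2) = z" for z :: "real^2"
    by (simp add: vec_eq_iff forall_2)
  show "form_eval (act (g ** h) f) x y = form_eval (act g (act h f)) x y" for x y
    by (simp add: form_eval_act Let_def vec det_mul vector_matrix_mul_assoc)
qed

definition V_R :: "nat \<Rightarrow> real cubic_form set" where
  "V_R i = (if i = 0 then {f. Disc f > 0} else {f. Disc f < 0})"

definition V_Z :: "nat \<Rightarrow> real cubic_form set" where
  "V_Z i = V_R i \<inter> range (map_form real_of_int)"

definition V_Z_irr :: "nat \<Rightarrow> real cubic_form set" where
  "V_Z_irr i = {f \<in> V_Z i. \<exists>h :: rat cubic_form.
                  f = map_form real_of_rat h \<and> irreducible (form_poly h)}"


section \<open>Gauss's fundamental domain\<close>

definition n_mat :: "real \<Rightarrow> real^2^2" where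
  "n_mat u = vector [vector [1, 0], vector [u, 1]]"

definition a_mat :: "real \<Rightarrow> real^2^2" where
  "a_mat t = vector [vector [inverse t, 0], vector [0, t]]"

definition t0 :: real where
  "t0 = root 4 3 / sqrt 2"

text \<open>
  The set \<open>\<nu>(t)\<close> is determined only up to boundary points, so it is kept as a parameter
  between the open and the closed version of the region.  This already makes \<open>\<nu>(t)\<close>
  a union of at most two intervals.
\<close>

definition gauss_fibre :: "(real \<Rightarrow> real set) \<Rightarrow> bool" where
  "gauss_fibre \<nu> \<longleftrightarrow>
     (\<forall>t\<ge>t0. {u \<in> {-1/2<..<1/2}. u^2 + t^4 > 1} \<subseteq> \<nu> t \<and>
              \<nu> t \<subseteq> {u \<in> {-1/2..1/2}. u^2 + t^4 \<ge> 1}) \<and>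
     (\<forall>t\<ge>1. \<nu> t = {-1/2..1/2})"

definition gauss_domain :: "(real \<Rightarrow> real set) \<Rightarrow> (real^2^2) set" where
  "gauss_domain \<nu> = {n_mat u ** a_mat t ** k ** mat l | u t k l.
      u \<in> \<nu> t \<and> t \<ge> t0 \<and> rotation_matrix k \<and> l > 0}"

definition gauss_cusp :: "(real \<Rightarrow> real set) \<Rightarrow> real \<Rightarrow> (real^2^2) set" where
  "gauss_cusp \<nu> T = {n_mat u ** a_mat t ** k ** mat l | u t k l.
      u \<in> \<nu> t \<and> t \<ge> t0 \<and> rotation_matrix k \<and> l > 0 \<and> t > T}"


section \<open>The Delone--Faddeev algebra and the shape parameter\<close>

text \<open>The coordinates of \<open>real^3\<close> refer to the basis \<open>1, \<omega>, \<theta>\<close>.\<close>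

definition df_one :: "real^3" where "df_one = axis 1 1"
definition df_omega :: "real^3" where "df_omega = axis 2 1"
definition df_theta :: "real^3" where "df_theta = axis 3 1"

text \<open>
  Bilinear extension of \<open>\<omega>\<theta> = -ad\<close>, \<open>\<omega>^2 = -ac + b\<omega> - a\<theta>\<close> and
  \<open>\<theta>^2 = -bd + d\<omega> - c\<theta>\<close>, with \<open>1\<close> as unit.
\<close>

fun df_mult :: "real cubic_form \<Rightarrow> real^3 \<Rightarrow> real^3 \<Rightarrow> real^3" where
  "df_mult (a, b, c, d) x y = vector
    [x$1 * y$1 - a * c * (x$2 * y$2) - a * d * (x$2 * y$3 + x$3 * y$2) - b * d * (x$3 * y$3),
     x$1 * y$2 + x$2 * y$1 + b * (x$2 * y$2) + d * (x$3 * y$3),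
     x$1 * y$3 + x$3 * y$1 - a * (x$2 * y$2) - c * (x$3 * y$3)]"

lemma df_mult_table:
  "df_mult (a, b, c, d) df_omega df_theta = (- a * d) *\<^sub>R df_one"
  "df_mult (a, b, c, d) df_omega df_omega =
     (- a * c) *\<^sub>R df_one + b *\<^sub>R df_omega - a *\<^sub>R df_theta"
  "df_mult (a, b, c, d) df_theta df_theta =
     (- b * d) *\<^sub>R df_one + d *\<^sub>R df_omega - c *\<^sub>R df_theta"
  "df_mult f df_one x = x" "df_mult f x y = df_mult f y x"
  by (cases f; simp add: vec_eq_iff forall_3 vector_3 df_one_def df_omega_def df_theta_def
      axis_def algebra_simps)+

definition df_trace :: "real cubic_form \<Rightarrow> real^3 \<Rightarrow> real" where
  "df_trace f x = trace (matrix (df_mult f x))"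

definition df_traceless :: "real cubic_form \<Rightarrow> real^3 \<Rightarrow> real^3" where
  "df_traceless f x = x - (df_trace f x / 3) *\<^sub>R df_one"

text \<open>Isomorphisms of \<open>\<real>\<close>-algebras onto \<open>\<real> \<oplus> \<complex>\<close>.\<close>

definition df_iso :: "real cubic_form \<Rightarrow> (real^3 \<Rightarrow> real \<times> complex) \<Rightarrow> bool" where
  "df_iso f \<Phi> \<longleftrightarrow> linear \<Phi> \<and> bij \<Phi> \<and> \<Phi> df_one = (1, 1) \<and>
     (\<forall>x y. \<Phi> (df_mult f x y) = (fst (\<Phi> x) * fst (\<Phi> y), snd (\<Phi> x) * snd (\<Phi> y)))"

text \<open>The identification of \<open>(\<real> \<oplus> \<complex>) / \<real>(1,1)\<close> with \<open>\<complex>\<close>.\<close>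

definition mod_diag :: "real \<times> complex \<Rightarrow> complex" where
  "mod_diag w = snd w - of_real (fst w)"

definition shape :: "real cubic_form \<Rightarrow> complex" where
  "shape f =
    (if Disc f < 0 then
       (THE \<tau>. Im \<tau> > 0 \<and>
         (\<exists>\<Phi>. df_iso f \<Phi> \<and> \<tau> = mod_diag (\<Phi> df_theta) / mod_diag (\<Phi> df_omega)))
     else
       (let w = df_traceless f df_omega; h = df_traceless f df_theta;
            A = df_trace f (df_mult f w w);
            B = df_trace f (df_mult f w h);
            C = df_trace f (df_mult f h h)
        in (of_real B + \<i> * of_real (sqrt (A * C - B^2))) / of_real A))"


section \<open>Normalized Weierstrass models and their counts\<close>

definition SL2_Z :: "(real^2^2) set" where
  "SL2_Z = {M. (\<forall>i j. M$i$j \<in> \<int>) \<and> det M = 1}"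

definition completes :: "int \<times> int \<Rightarrow> real^2^2 \<Rightarrow> bool" where
  "completes P M \<longleftrightarrow> M \<in> SL2_Z \<and> M$1 = vector [of_int (fst P), of_int (snd P)]"

text \<open>
  The triple \<open>(u, A, B)\<close> stands for the equation \<open>y^2 = x^3 + u x^2 + A x + B\<close>, with
  \<open>u \<in> {0, 1, 2}\<close>.  For \<open>f\<close> integral with \<open>f(P) = 1\<close> all reals to which the floor is applied
  are integers, and the result does not depend on the matrix chosen by \<open>SOME\<close>; see
  \<open>model_exists\<close> and \<open>model_eqI\<close> below.
\<close>

definition weierstrass_model :: "real cubic_form \<Rightarrow> int \<times> int \<Rightarrow> int \<times> int \<times> int" where
  "weierstrass_model f P =
    (let M = (SOME M. completes P M);
         (_, b, _, _) = act M f;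
         u = \<lfloor>b\<rfloor> mod 3;
         k = (of_int u - b) / 3;
         (_, _, A, B) = act (n_mat k ** M) f
     in (u, \<lfloor>A\<rfloor>, \<lfloor>B\<rfloor>))"

lemma completes_unique:
  assumes "completes P M" and "completes P M'"
  obtains m :: int where "M' = n_mat (of_int m) ** M"
proof -
  define x y where "x = real_of_int (fst P)" and "y = real_of_int (snd P)"
  define r s r' s' where rs: "r = M$2$1" "s = M$2$2" "r' = M'$2$1" "s' = M'$2$2"
  have M: "M$1$1 = x" "M$1$2 = y" "M'$1$1 = x" "M'$1$2 = y"
    using assms by (simp_all add: completes_def x_def y_def)
  have det: "x * s - y * r = 1" "x * s' - y * r' = 1"
    using assms by (simp_all add: completes_def SL2_Z_def det_2 M rs)
  have "r \<in> \<int>" "s \<in> \<int>" "r' \<in> \<int>" "s' \<in> \<int>"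
    using assms by (simp_all add: completes_def SL2_Z_def rs)
  then have "(r' - r) * s - (s' - s) * r \<in> \<int>" by simp
  then obtain m where m: "(r' - r) * s - (s' - s) * r = of_int m" by (auto elim: Ints_cases)
  have "r' = of_int m * x + r" "s' = of_int m * y + s"
    using det m by algebra+
  then have "M' = n_mat (of_int m) ** M"
    by (simp add: vec_eq_iff forall_2 matrix_matrix_mult_def sum_2 n_mat_def M rs[symmetric])
  then show thesis by (rule that)
qed

lemma n_mat_add: "n_mat u ** n_mat w = n_mat (u + w)"
  by (simp add: vec_eq_iff forall_2 matrix_matrix_mult_def sum_2 n_mat_def)

lemma act_n_mat_monic:
  "\<exists>A' B'. act (n_mat j) (1, b, A, B) = (1, b + 3 * j, A', B')"
  by (simp add: n_mat_def det_2 Let_def)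

lemma model_eqI:
  assumes M: "completes P M" and u: "u \<in> {0, 1, 2}"
    and F: "act (n_mat (of_int k) ** M) f = (1, of_int u, of_int A, of_int B)"
  shows "weierstrass_model f P = (u, A, B)"
proof -
  define M' where "M' = (SOME M. completes P M)"
  have "\<exists>M. completes P M" using M by blast
  then have "completes P M'" unfolding M'_def by (rule someI_ex)
  then obtain m where m: "M' = n_mat (of_int m) ** M" using completes_unique[OF M] by blast
  have M': "n_mat t ** M' = n_mat (t + of_int m) ** M" for t
    by (simp add: m matrix_mul_assoc n_mat_add)
  have "M' = n_mat (of_int (m - k)) ** (n_mat (of_int k) ** M)"
    by (simp add: m matrix_mul_assoc n_mat_add)
  then have "act M' f = act (n_mat (of_int (m - k))) (1, of_int u, of_int A, of_int B)"
    by (simp only: act_mult F[unfolded act_mult])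
  then obtain A' B' where b: "act M' f = (1, of_int (u + 3 * (m - k)), A', B')"
    using act_n_mat_monic[of "of_int (m - k)" "of_int u" "of_int A" "of_int B"] by auto
  have "\<lfloor>real_of_int (u + 3 * (m - k))\<rfloor> mod 3 = u"
    unfolding floor_of_int mod_mult_self2 using u by auto
  moreover have "(of_int u - real_of_int (u + 3 * (m - k))) / 3 + of_int m = of_int k"
    by (simp add: field_simps)
  ultimately show ?thesis
    unfolding weierstrass_model_def M'_def[symmetric] Let_def b M' prod.case by (simp add: F)
qed

lemma model_exists:
  assumes f: "f \<in> range (map_form real_of_int)"
    and P: "coprime (fst P) (snd P)" "form_eval f (of_int (fst P)) (of_int (snd P)) = 1"
  obtains M u k A B where "completes P M" "u \<in> {0, 1, 2}"
    "act (n_mat (of_int k) ** M) f = (1, of_int u, of_int A, of_int B)"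
proof -
  have "\<exists>x y. x * fst P + y * snd P = 1"
    using P(1) by (metis bezout_int coprime_imp_gcd_eq_1)
  then obtain x y where xy: "x * fst P + y * snd P = 1" by blast
  define M :: "real^2^2" where
    "M = vector [vector [of_int (fst P), of_int (snd P)], vector [of_int (- y), of_int x]]"
  have "det M = of_int (x * fst P + y * snd P)" by (simp add: M_def det_2)
  then have M: "completes P M"
    using xy by (simp add: completes_def SL2_Z_def forall_2 M_def)
  have int: "act N g \<in> range (map_form real_of_int)"
    if N: "N \<in> SL2_Z" and g: "g \<in> range (map_form real_of_int)" for N g
  proof -
    obtain a b c d where "g = map_form real_of_int (a, b, c, d)" using g by auto
    then have g: "g = (of_int a, of_int b, of_int c, of_int d)" by simp
    have ent: "N$i$j \<in> \<int>" for i j using N by (simp add: SL2_Z_def)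
    obtain p where p: "N$1$1 = of_int p" using ent[of 1 1] by (rule Ints_cases)
    obtain q where q: "N$1$2 = of_int q" using ent[of 1 2] by (rule Ints_cases)
    obtain r where r: "N$2$1 = of_int r" using ent[of 2 1] by (rule Ints_cases)
    obtain s where s: "N$2$2 = of_int s" using ent[of 2 2] by (rule Ints_cases)
    have det: "det N = 1" using N by (simp add: SL2_Z_def)
    have "act N g = map_form real_of_int
      (a * p^3 + b * p^2 * q + c * p * q^2 + d * q^3,
       3 * a * p^2 * r + b * (p^2 * s + 2 * p * q * r) + c * (2 * p * q * s + q^2 * r) + 3 * d * q^2 * s,
       3 * a * p * r^2 + b * (2 * p * r * s + q * r^2) + c * (p * s^2 + 2 * q * r * s) + 3 * d * q * s^2,
       a * r^3 + b * r^2 * s + c * r * s^2 + d * s^3)"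
      by (simp add: g p q r s det Let_def)
    then show ?thesis by (rule range_eqI)
  qed
  have "act M f \<in> range (map_form real_of_int)" by (rule int[OF _ f]) (use M in \<open>simp add: completes_def\<close>)
  then obtain a b c d where "act M f = map_form real_of_int (a, b, c, d)" by auto
  then have act: "act M f = (of_int a, of_int b, of_int c, of_int d)" by simp
  have "form_eval (act M f) 1 0 = 1"
    using M P(2) by (simp add: form_eval_act Let_def completes_def SL2_Z_def
        vector_matrix_mult_def sum_2)
  then have a: "a = 1" by (simp add: act)
  define k where "k = - (b div 3)"
  have b: "b + 3 * k = b mod 3" using div_mult_mod_eq[of b 3] unfolding k_def by linarith
  have "n_mat (of_int k) \<in> SL2_Z"
    by (simp add: SL2_Z_def forall_2 n_mat_def det_2)
  then have "act (n_mat (of_int k)) (act M f) \<in> range (map_form real_of_int)"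
    by (rule int) (simp add: act image_iff split_paired_Ex)
  then obtain a' b' A B where "act (n_mat (of_int k)) (act M f) = map_form real_of_int (a', b', A, B)"
    by auto
  then have F: "act (n_mat (of_int k)) (act M f) = (of_int a', of_int b', of_int A, of_int B)"
    by simp
  obtain A' B' where
    "act (n_mat (of_int k)) (1, of_int b, of_int c, of_int d) = (1, of_int b + 3 * of_int k, A', B')"
    using act_n_mat_monic[of "of_int k" "of_int b" "of_int c" "of_int d"] by (elim exE that)
  then have "real_of_int a' = 1" "real_of_int b' = of_int (b + 3 * k)"
    using F unfolding act a of_int_1 by (simp_all only: prod.inject of_int_add of_int_mult of_int_numeral)
  then have "a' = 1" "b' = b mod 3"
    by (simp_all only: of_int_eq_iff of_int_eq_1_iff b)
  with F have F': "act (n_mat (of_int k) ** M) f = (1, of_int (b mod 3), of_int A, of_int B)"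
    by (simp only: act_mult of_int_1)
  have "b mod 3 \<in> {0, 1, 2}" by auto
  then show thesis by (rule that[OF M _ F'])
qed

definition prim_box :: "real \<Rightarrow> (int \<times> int) set" where
  "prim_box Y = {(\<alpha>, \<beta>). coprime \<alpha> \<beta> \<and> Y \<le> \<bar>of_int \<alpha>\<bar> \<and> \<bar>of_int \<alpha>\<bar> < 2 * Y \<and>
                                      Y \<le> \<bar>of_int \<beta>\<bar> \<and> \<bar>of_int \<beta>\<bar> < 2 * Y}"

text \<open>
  The pairs \<open>(f, P)\<close> with \<open>f \<in> S v\<close>, for a set \<open>S\<close> of matrices.  Multiplicities of \<open>f\<close> in
  the multiset \<open>S v\<close> are dropped: only the set of models obtained is ever counted.
\<close>

definition solution_pairs :: "(real^2^2) set \<Rightarrow> real cubic_form \<Rightarrow> nat \<Rightarrow> real \<Rightarrow> real \<Rightarrow>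
    real \<Rightarrow> real \<Rightarrow> (real cubic_form \<times> (int \<times> int)) set" where
  "solution_pairs S v i cm cp X Y =
     {(f, P). P \<in> prim_box Y \<and> f \<in> (\<lambda>g. act g v) ` S \<and> f \<in> V_Z_irr i \<and>
        form_eval f (of_int (fst P)) (of_int (snd P)) = 1 \<and>
        cm * X \<le> \<bar>Disc f\<bar> \<and> \<bar>Disc f\<bar> < cp * X}"

definition model_count :: "(real^2^2) set \<Rightarrow> real cubic_form \<Rightarrow> nat \<Rightarrow> real \<Rightarrow> real \<Rightarrow>
    real \<Rightarrow> real \<Rightarrow> nat" where
  "model_count S v i cm cp X Y =
     card ((\<lambda>(f, P). weierstrass_model f P) ` solution_pairs S v i cm cp X Y)"

end

theory Submission
  imports Defs
begin

text \<open>
  Every bound is proved for each \<open>P = (\<alpha>, \<beta>)\<close> separately, with the same main term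
  \<open>(X^{1/4} / Y)^3\<close>, so the number of points of the box cancels from the quotient.

  A form \<open>n(u) a(t) k \<lambda> v\<close> has \<open>|a| \<lless> \<lambda> / t^3\<close>, \<open>|b| \<lless> \<lambda> / t\<close>, \<open>|c| \<lless> \<lambda> t\<close>, and the
  equation \<open>f(P) = 1\<close> determines \<open>d\<close> and fixes each of \<open>a\<close>, \<open>b\<close>, \<open>c\<close> modulo \<open>\<beta>\<close> in terms of the
  preceding ones.  It also forces \<open>a \<noteq> 0\<close>, hence \<open>t^3 \<lless> \<lambda> / |a|\<close>; summing over the
  residue class of \<open>a\<close> gives \<open>T^{-3} (X^{1/4} / Y)^3\<close> forms in the cusp.

  Conversely, rotating \<open>v\<close> so that it vanishes at \<open>P\<close> gives a real form in the interior of the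
  fundamental domain, with a neighbourhood of uniform size by compactness.  The dilated
  neighbourhood contains \<open>\<ggreater> (X^{1/4} / Y)^3\<close> integral forms with \<open>f(P) = 1\<close> that have no root
  modulo 2 and are therefore irreducible.  Two such pairs with the same model differ by some
  \<open>\<gamma> \<in> SL\<^sub>2(\<int>)\<close>, and the action is proper on forms of nonzero discriminant, so only
  boundedly many \<open>\<gamma>\<close> occur.
\<close>

section \<open>Binary cubic forms under the twisted action\<close>

fun form_bounded :: "real \<Rightarrow> real cubic_form \<Rightarrow> bool" where
  "form_bounded m (a, b, c, d) \<longleftrightarrow> \<bar>a\<bar> \<le> m \<and> \<bar>b\<bar> \<le> m \<and> \<bar>c\<bar> \<le> m \<and> \<bar>d\<bar> \<le> m"

lemma Disc_map_form_divide: "Disc (map_form (\<lambda>x. x / e) f) = Disc f / e^4"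
proof -
  obtain a b c d where f: "f = (a, b, c, d)" by (cases f)
  have "Disc (map_form (\<lambda>x. x * y) f) = Disc f * y^4" for y
    unfolding f map_form.simps Disc.simps by algebra
  from this[of "inverse e"] show ?thesis by (simp add: divide_inverse power_inverse)
qed

text \<open>Plain substitution multiplies the discriminant by \<open>(det g)^6\<close>. The twist
  divides every coefficient by \<open>det g\<close>, and \<open>Disc\<close> is homogeneous of
  degree 4, so \<open>(det g)^4\<close> is lost again.\<close>

lemma Disc_act:
  assumes "det g \<noteq> 0"
  shows "Disc (act g f) = (det g)^2 * Disc f"
proof -
  obtain a b c d where f: "f = (a, b, c, d)" by (cases f)
  obtain p q r s where g: "g$1$1 = p" "g$1$2 = q" "g$2$1 = r" "g$2$2 = s" by blast
  have "Disc (a * p^3 + b * p^2 * q + c * p * q^2 + d * q^3,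
       3 * a * p^2 * r + b * (p^2 * s + 2 * p * q * r) + c * (2 * p * q * s + q^2 * r) + 3 * d * q^2 * s,
       3 * a * p * r^2 + b * (2 * p * r * s + q * r^2) + c * (p * s^2 + 2 * q * r * s) + 3 * d * q * s^2,
       a * r^3 + b * r^2 * s + c * r * s^2 + d * s^3) = (p * s - q * r)^6 * Disc (a, b, c, d)"
    unfolding Disc.simps by algebra
  then have "Disc (act g f) = (det g)^6 * Disc f / (det g)^4"
    unfolding f act.simps Let_def Disc_map_form_divide g det_2 by (simp only:)
  moreover have "e^6 * x / e^4 = e^2 * x" if "e \<noteq> 0" for e x :: real
    using that by (simp add: field_simps flip: power_add)
  ultimately show ?thesis using assms by metis
qed

lemma act_mat:
  assumes "l \<noteq> 0" shows "act (mat l) (a, b, c, d) = (l * a, l * b, l * c, l * d)"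
  using assms by (simp add: det_2 mat_def Let_def field_simps power2_eq_square power3_eq_cube)

lemma det_mat_2: "det (mat l :: real^2^2) = l^2"
  by (simp add: det_2 mat_def power2_eq_square)

lemma det_a_mat: "t \<noteq> 0 \<Longrightarrow> det (a_mat t) = 1"
  by (simp add: a_mat_def det_2)

lemma det_n_mat: "det (n_mat t) = 1"
  by (simp add: n_mat_def det_2)

lemma act_a_mat:
  assumes "t \<noteq> 0" shows "act (a_mat t) (a, b, c, d) = (a / t^3, b / t, c * t, d * t^3)"
  using assms by (simp add: det_2 a_mat_def Let_def field_simps power2_eq_square power3_eq_cube)

lemma act_n_mat:
  "act (n_mat u) (a, b, c, d) = (a, b + 3 * a * u, c + 2 * b * u + 3 * a * u^2, d + c * u + b * u^2 + a * u^3)"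
  by (simp add: det_2 n_mat_def Let_def field_simps)

lemma act_swap: "act (vector [vector [0, 1], vector [-1, 0]]) (a, b, c, d) = (d, -c, b, -a)"
  by (simp add: det_2 Let_def)

declare act.simps [simp del] Disc.simps [simp del]

section \<open>Rotations and the size of forms in Gauss coordinates\<close>

lemma rotation_entry:
  fixes k :: "real^2^2"
  assumes "rotation_matrix k" shows "\<bar>k$i$j\<bar> \<le> 1"
proof -
  have "norm (k $ i) = 1"
    using assms by (simp add: rotation_matrix_def orthogonal_matrix_orthonormal_rows row_def vec_lambda_eta)
  then show ?thesis using component_le_norm_cart[of "k $ i" j] by simp
qed

lemma rotation_det: "rotation_matrix k \<Longrightarrow> det k = 1"
  by (simp add: rotation_matrix_def)

lemma abs_mult3_le:
  fixes a x y z m :: real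
  assumes "\<bar>a\<bar> \<le> m" "\<bar>x\<bar> \<le> 1" "\<bar>y\<bar> \<le> 1" "\<bar>z\<bar> \<le> 1"
  shows "\<bar>a * (x * y * z)\<bar> \<le> m"
proof -
  have "\<bar>x * y * z\<bar> \<le> 1 * 1 * 1" unfolding abs_mult using assms by (intro mult_mono) auto
  then have "\<bar>a\<bar> * \<bar>x * y * z\<bar> \<le> m * 1" using assms by (intro mult_mono) auto
  then show ?thesis by (simp add: abs_mult)
qed

text \<open>The constant counts monomials: with entries of size at most 1, each new coefficient is a
  sum of at most 12 terms bounded by \<open>m\<close>, the middle two coefficients attaining
  \<open>3 + 3 + 3 + 3\<close>.\<close>

lemma form_bounded_act:
  assumes "det g = 1" "\<And>i j. \<bar>g$i$j\<bar> \<le> 1" "form_bounded m f"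
  shows "form_bounded (12 * m) (act g f)"
proof -
  obtain a b c d where f: "f = (a, b, c, d)" by (cases f)
  obtain p q r s where g: "g$1$1 = p" "g$1$2 = q" "g$2$1 = r" "g$2$2 = s" by blast
  have pq: "\<bar>p\<bar> \<le> 1" "\<bar>q\<bar> \<le> 1" "\<bar>r\<bar> \<le> 1" "\<bar>s\<bar> \<le> 1" using assms(2) g by metis+
  have m: "\<bar>a\<bar> \<le> m" "\<bar>b\<bar> \<le> m" "\<bar>c\<bar> \<le> m" "\<bar>d\<bar> \<le> m" using assms(3) f by auto
  have "\<bar>a * p^3 + b * p^2 * q + c * p * q^2 + d * q^3\<bar> \<le> 12 * m"
    using abs_mult3_le[OF m(1) pq(1) pq(1) pq(1)] abs_mult3_le[OF m(2) pq(1) pq(1) pq(2)]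
      abs_mult3_le[OF m(3) pq(1) pq(2) pq(2)] abs_mult3_le[OF m(4) pq(2) pq(2) pq(2)]
    by (simp add: power2_eq_square power3_eq_cube algebra_simps)
  moreover have "\<bar>3 * a * p^2 * r + b * (p^2 * s + 2 * p * q * r) + c * (2 * p * q * s + q^2 * r) + 3 * d * q^2 * s\<bar> \<le> 12 * m"
    using abs_mult3_le[OF m(1) pq(1) pq(1) pq(3)] abs_mult3_le[OF m(2) pq(1) pq(1) pq(4)]
      abs_mult3_le[OF m(2) pq(1) pq(2) pq(3)]  abs_mult3_le[OF m(3) pq(1) pq(2) pq(4)]
      abs_mult3_le[OF m(3) pq(2) pq(2) pq(3)] abs_mult3_le[OF m(4) pq(2) pq(2) pq(4)]
    by (simp add: power2_eq_square power3_eq_cube algebra_simps)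
  moreover have "\<bar>3 * a * p * r^2 + b * (2 * p * r * s + q * r^2) + c * (p * s^2 + 2 * q * r * s) + 3 * d * q * s^2\<bar> \<le> 12 * m"
    using abs_mult3_le[OF m(1) pq(1) pq(3) pq(3)] abs_mult3_le[OF m(2) pq(1) pq(3) pq(4)]
      abs_mult3_le[OF m(2) pq(2) pq(3) pq(3)]  abs_mult3_le[OF m(3) pq(1) pq(4) pq(4)]
      abs_mult3_le[OF m(3) pq(2) pq(3) pq(4)] abs_mult3_le[OF m(4) pq(2) pq(4) pq(4)]
    by (simp add: power2_eq_square power3_eq_cube algebra_simps)
  moreover have "\<bar>a * r^3 + b * r^2 * s + c * r * s^2 + d * s^3\<bar> \<le> 12 * m"
    using abs_mult3_le[OF m(1) pq(3) pq(3) pq(3)] abs_mult3_le[OF m(2) pq(3) pq(3) pq(4)]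
      abs_mult3_le[OF m(3) pq(3) pq(4) pq(4)] abs_mult3_le[OF m(4) pq(4) pq(4) pq(4)]
    by (simp add: power2_eq_square power3_eq_cube algebra_simps)
  ultimately show ?thesis
    unfolding f act.simps Let_def map_form.simps form_bounded.simps g assms(1) div_by_1 by (intro conjI)
qed

lemma t0_pos: "0 < t0" by (simp add: t0_def)

lemma t0_pow4: "t0^4 = 3/4"
proof -
  have "root 4 3 ^ 4 = (3::real)" by simp
  moreover have "(sqrt 2)^4 = ((sqrt 2)^2)^2" by (simp only: flip: power_mult) simp
  ultimately show ?thesis by (simp add: t0_def power_divide)
qed

lemma t0_square: "t \<ge> t0 \<Longrightarrow> t^2 \<ge> 1/2"
proof -
  assume "t \<ge> t0"
  then have "t0^4 \<le> t^4" using t0_pos by (intro power_mono) auto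
  then have "(1/2)^2 \<le> (t^2)^2" by (simp add: t0_pow4 power_divide)
  then show ?thesis by (rule power2_le_imp_le) simp
qed

lemma t0_le_1: "t0 \<le> 1"
proof (rule ccontr)
  assume "\<not> ?thesis"
  then have "1^4 \<le> t0^4" by (intro power_mono) auto
  then show False by (simp add: t0_pow4)
qed

text \<open>The scalar and the rotation leave coefficients of size \<open>12 * m * l\<close>, which
  \<open>a_mat t\<close> then weights by \<open>t^-3\<close>, \<open>t^-1\<close>, \<open>t\<close>.
  Since \<open>\<bar>u\<bar> \<le> 1/2\<close>, \<open>n_mat u\<close> only adds multiples of
  earlier, smaller coefficients. No bound on \<open>d\<close> is recorded because the equation at
  \<open>P\<close> will determine it.\<close>

lemma cusp_coeffs:
  assumes "gauss_fibre \<nu>" and "(a, b, c, d) \<in> (\<lambda>g. act g v) ` gauss_cusp \<nu> T" and v: "form_bounded m v"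
  obtains t l where "t > T" "t \<ge> t0" "l > 0" "Disc (a, b, c, d) = l^4 * Disc v"
    "\<bar>a\<bar> \<le> 12 * m * l / t^3" "\<bar>b\<bar> \<le> 48 * m * l / t" "\<bar>c\<bar> \<le> 72 * m * l * t"
proof -
  obtain u t k l where ut: "u \<in> \<nu> t" "t \<ge> t0" "rotation_matrix k" "l > 0" "t > T"
    and f: "(a, b, c, d) = act (n_mat u ** a_mat t ** k ** mat l) v"
    using assms(2) unfolding gauss_cusp_def by blast
  have t: "t > 0" using ut t0_pos by linarith
  have u: "\<bar>u\<bar> \<le> 1/2" using assms(1) ut unfolding gauss_fibre_def by fastforce
  obtain va vb vc vd where v': "v = (va, vb, vc, vd)" by (cases v)
  have m: "m \<ge> 0" using v v' by auto
  have "form_bounded (m * l) (act (mat l) v)"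
    using v ut(4) unfolding v' by (simp add: act_mat abs_mult mult.commute)
  then have fb: "form_bounded (12 * (m * l)) (act k (act (mat l) v))"
    using ut by (intro form_bounded_act rotation_det rotation_entry)
  obtain a1 b1 c1 d1 where w: "act k (act (mat l) v) = (a1, b1, c1, d1)" by (metis prod_cases4)
  have bd: "\<bar>a1\<bar> \<le> 12 * m * l" "\<bar>b1\<bar> \<le> 12 * m * l" "\<bar>c1\<bar> \<le> 12 * m * l" using fb w by auto
  have f2: "(a, b, c, d) = act (n_mat u) (act (a_mat t) (a1, b1, c1, d1))"
    using f by (simp add: act_mult w)
  have D: "Disc (a, b, c, d) = l^4 * Disc v"
    unfolding f using ut t
    by (subst Disc_act) (simp_all add: det_mul det_a_mat det_n_mat rotation_det det_mat_2 flip: power_mult)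
  define M where "M = 12 * m * l"
  have M: "\<bar>a1\<bar> \<le> M" "\<bar>b1\<bar> \<le> M" "\<bar>c1\<bar> \<le> M" "M \<ge> 0" using bd unfolding M_def by linarith+
  have a: "a = a1 / t^3" and b: "b = b1 / t + 3 * (a1 / t^3) * u"
    and c: "c = c1 * t + 2 * (b1 / t) * u + 3 * (a1 / t^3) * u^2"
    using f2 t by (simp_all add: act_a_mat act_n_mat)
  have A: "\<bar>a\<bar> \<le> M / t^3" using M t by (simp add: a divide_right_mono)
  \<comment> \<open>In the domain \<open>t\<close> is bounded below, so
    \<open>1 / t^3 \<le> 2 / t\<close> and \<open>1 / t \<le> 2 * t\<close>. The terms added by
    \<open>n_mat u\<close> are therefore absorbed at the cost of the factors 4 for \<open>b\<close>
    and 6 for \<open>c\<close>.\<close>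
  have t2: "1 / t^2 \<le> 2" using t0_square[OF ut(2)] t by (simp add: field_simps)
  have "M / t^3 = M / t * (1 / t^2)" using t by (simp add: field_simps power2_eq_square power3_eq_cube)
  also have "\<dots> \<le> 2 * (M / t)" unfolding mult.commute[of 2] using M t t2 by (intro mult_left_mono) auto
  finally have A2: "\<bar>a\<bar> \<le> 2 * (M / t)" using A by (rule order_trans[rotated])
  define N where "N = M / t"
  define b' where "b' = b1 / t"
  have N: "N \<ge> 0" using M t by (simp add: N_def)
  have A2': "\<bar>a\<bar> \<le> 2 * N" using A2 by (simp only: N_def)
  have B1: "\<bar>b'\<bar> \<le> N" using M t by (simp add: divide_right_mono b'_def N_def)
  have "\<bar>a * u\<bar> \<le> (2 * N) * (1/2)" unfolding abs_mult using A2' u N by (intro mult_mono) auto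
  then have au: "\<bar>a * u\<bar> \<le> N" by simp
  have "b = b' + 3 * (a * u)" unfolding b a b'_def by simp
  then have B: "\<bar>b\<bar> \<le> 4 * N" using au B1 by linarith
  have "M / t = M * t * (1 / t^2)" using t by (simp add: field_simps power2_eq_square power3_eq_cube)
  also have "\<dots> \<le> 2 * (M * t)" unfolding mult.commute[of 2] using M t t2 by (intro mult_left_mono) auto
  finally have Mt: "N \<le> 2 * (M * t)" unfolding N_def .
  have "\<bar>a * u * u\<bar> \<le> N * (1/2)"
    unfolding abs_mult[of "a * u"] using au u N by (intro mult_mono) auto
  moreover have "\<bar>b' * u\<bar> \<le> N * (1/2)" unfolding abs_mult[of b'] using B1 u N by (intro mult_mono) auto
  moreover have "\<bar>c1 * t\<bar> \<le> M * t" unfolding abs_mult using M t by (intro mult_mono) auto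
  moreover have "c = c1 * t + 2 * (b' * u) + 3 * (a * u * u)" unfolding c a b'_def by (simp add: power2_eq_square)
  ultimately have C: "\<bar>c\<bar> \<le> 6 * (M * t)" using Mt by linarith
  show thesis
  proof (rule that[OF ut(5,2,4) D])
    show "\<bar>a\<bar> \<le> 12 * m * l / t^3" using A by (simp only: M_def)
    show "\<bar>b\<bar> \<le> 48 * m * l / t" using B by (simp add: M_def N_def)
    show "\<bar>c\<bar> \<le> 72 * m * l * t" using C by (simp add: M_def)
  qed
qed

text \<open>
  Iwasawa decomposition \<open>\<gamma> = n(\<mu>) a(1/R) k\<close>: undoing \<open>n(\<mu>)\<close> and \<open>k\<close> costs only constants, and
  \<open>a(1/R)\<close> multiplies the first two coefficients of \<open>k \<cdot> f\<close> by \<open>R^3\<close> and \<open>R\<close>, so they must be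
  small, and with them the discriminant.
\<close>

lemma act_proper_aux:
  fixes \<gamma> :: "real^2^2"
  assumes \<gamma>: "\<gamma>$1$1 = p" "\<gamma>$1$2 = q" "\<gamma>$2$1 = r" "\<gamma>$2$2 = s"
    and "det \<gamma> = 1" and fb: "form_bounded m f" and fb': "form_bounded m (act \<gamma> f)"
    and le: "r^2 + s^2 \<le> p^2 + q^2"
  shows "(p^2 + q^2) * \<bar>Disc f\<bar> \<le> 54 * (12 * m)^4"
proof -
  have det: "p * s - q * r = 1" using assms(5) by (simp add: det_2 \<gamma>)
  define R where "R = sqrt (p^2 + q^2)"
  have R2: "R^2 = p^2 + q^2" by (simp add: R_def)
  \<comment> \<open>Lagrange's identity for the two rows. As the first row is the longer one, it
    yields both \<open>R \<ge> 1\<close> and \<open>\<bar>\<mu>\<bar> \<le> 1\<close>.\<close>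
  have "1 = (p * s - q * r)^2" using det by simp
  also have "\<dots> = (p^2 + q^2) * (r^2 + s^2) - (p * r + q * s)^2" by algebra
  finally have cs: "1 + (p * r + q * s)^2 = (p^2 + q^2) * (r^2 + s^2)" by simp
  also have "\<dots> \<le> (p^2 + q^2) * (p^2 + q^2)" using le by (intro mult_left_mono) auto
  finally have RR: "1 + (p * r + q * s)^2 \<le> (R^2)^2" unfolding R2 by (simp only: power2_eq_square)
  have "1^2 \<le> (R^2)^2" using RR by (smt (verit) zero_le_power2 power_one)
  then have "1^2 \<le> R^2" by (metis power2_le_imp_le power_one zero_le_power2)
  then have R1: "1 \<le> R" by (rule power2_le_imp_le) (simp add: R_def)
  define \<mu> where "\<mu> = (p * r + q * s) / R^2"
  have "(p * r + q * s)^2 \<le> (R^2)^2" using RR by simp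
  then have "\<bar>p * r + q * s\<bar> \<le> R^2" by (metis abs_le_square_iff abs_power2 power2_abs)
  then have mu: "\<bar>\<mu>\<bar> \<le> 1" using R1 by (simp add: \<mu>_def)
  define k :: "real^2^2" where "k = vector [vector [p / R, q / R], vector [- q / R, p / R]]"
  have "(p / R)^2 + (q / R)^2 = (p^2 + q^2) / R^2" by (simp add: power_divide add_divide_distrib)
  also have "\<dots> = 1" unfolding R2[symmetric] using R1 by simp
  finally have sq: "(p / R)^2 + (q / R)^2 = 1" .
  have dk: "det k = 1" using sq by (simp add: k_def det_2 power2_eq_square)
  have "(p / R)^2 \<le> 1^2" "(q / R)^2 \<le> 1^2" using sq by (smt (verit) zero_le_power2 power_one)+
  then have "\<bar>p / R\<bar> \<le> 1" "\<bar>q / R\<bar> \<le> 1" by (metis abs_le_square_iff abs_one)+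
  then have ek: "\<bar>k$i$j\<bar> \<le> 1" for i j using exhaust_2[of i] exhaust_2[of j] by (auto simp: k_def)
  have en: "\<bar>n_mat (- \<mu>)$i$j\<bar> \<le> 1" for i j
    using exhaust_2[of i] exhaust_2[of j] mu by (auto simp: n_mat_def)
  have e1: "r * R^2 = (p * r + q * s) * p - q" "s * R^2 = (p * r + q * s) * q + p"
    using det unfolding R2 by algebra+
  have e2: "R \<noteq> 0" using R1 by simp
  have "n_mat (- \<mu>) ** \<gamma> = a_mat (1 / R) ** k"
    using e1 e2 by (simp add: vec_eq_iff forall_2 matrix_matrix_mult_def sum_2 n_mat_def a_mat_def k_def \<gamma> \<mu>_def divide_simps) (auto simp: algebra_simps power2_eq_square)
  then have eq: "act (n_mat (- \<mu>)) (act \<gamma> f) = act (a_mat (1 / R)) (act k f)"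
    by (metis act_mult)
  obtain a b c d where h: "act k f = (a, b, c, d)" by (metis prod_cases4)
  define M where "M = 12 * m"
  have "form_bounded M (act k f)" unfolding M_def by (intro form_bounded_act dk ek fb)
  then have cM: "\<bar>a\<bar> \<le> M" "\<bar>b\<bar> \<le> M" "\<bar>c\<bar> \<le> M" "\<bar>d\<bar> \<le> M" by (simp_all add: h)
  have "form_bounded M (act (n_mat (- \<mu>)) (act \<gamma> f))" unfolding M_def by (intro form_bounded_act det_n_mat en fb')
  then have R3: "\<bar>a * R^3\<bar> \<le> M" "\<bar>b * R\<bar> \<le> M" unfolding eq h using R1 by (simp_all add: act_a_mat power_divide)
  have "\<bar>a * R^2\<bar> \<le> \<bar>a * R^3\<bar>" unfolding abs_mult using R1 by (intro mult_left_mono) (auto simp: power_increasing)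
  then have aM: "\<bar>a * R^2\<bar> \<le> M" using R3 by simp
  have M4: "\<bar>x * y * z * w\<bar> \<le> M^4" if "\<bar>x\<bar> \<le> M" "\<bar>y\<bar> \<le> M" "\<bar>z\<bar> \<le> M" "\<bar>w\<bar> \<le> M" for x y z w
  proof -
    have "\<bar>x * y * z * w\<bar> \<le> M * M * M * M" unfolding abs_mult using that by (intro mult_mono) auto
    then show ?thesis by (simp add: power4_eq_xxxx)
  qed
  \<comment> \<open>Every monomial of the discriminant contains \<open>a\<close> or at least two
    factors \<open>b\<close>, so \<open>R^2\<close> can be absorbed as \<open>a * R^2\<close> or as
    \<open>(b * R) * (b * R)\<close>. The coefficients add up to
    \<open>1 + 4 + 4 + 27 + 18 = 54\<close>.\<close>
  have "R^2 * Disc f = R^2 * Disc (a, b, c, d)" using Disc_act[of k f] by (simp add: dk h)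
  also have "\<dots> = (b * R) * (b * R) * c * c - 4 * ((a * R^2) * c * c * c) - 4 * ((b * R) * (b * R) * b * d)
    - 27 * ((a * R^2) * a * d * d) + 18 * ((a * R^2) * b * c * d)"
    unfolding Disc.simps by algebra
  finally have "\<bar>R^2 * Disc f\<bar> \<le> 54 * M^4"
    using M4[OF R3(2) R3(2) cM(3) cM(3)] M4[OF aM cM(3) cM(3) cM(3)] M4[OF R3(2) R3(2) cM(2) cM(4)]
     M4[OF aM cM(1) cM(4) cM(4)] M4[OF aM cM(2) cM(3) cM(4)] by linarith
  then show ?thesis by (simp add: abs_mult R2 M_def)
qed

text \<open>The auxiliary bound controls the first row when it is the longer one. Otherwise the rows
  are exchanged by \<open>w\<close>, which only permutes the coefficients of the transformed form up
  to sign.\<close>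

lemma act_proper:
  fixes \<gamma> :: "real^2^2"
  assumes "det \<gamma> = 1" and fb: "form_bounded m f" and fb': "form_bounded m (act \<gamma> f)"
  shows "(\<gamma>$i$j)^2 * \<bar>Disc f\<bar> \<le> 54 * (12 * m)^4"
proof -
  obtain p q r s where g: "\<gamma>$1$1 = p" "\<gamma>$1$2 = q" "\<gamma>$2$1 = r" "\<gamma>$2$2 = s" by blast
  define w :: "real^2^2" where "w = vector [vector [0, 1], vector [-1, 0]]"
  have dw: "det w = 1" by (simp add: w_def det_2)
  have e: "(w ** \<gamma>)$1$1 = r" "(w ** \<gamma>)$1$2 = s" "(w ** \<gamma>)$2$1 = -p" "(w ** \<gamma>)$2$2 = -q"
    by (simp_all add: matrix_matrix_mult_def sum_2 w_def g)
  have fbw: "form_bounded m (act (w ** \<gamma>) f)"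
    unfolding act_mult using fb' unfolding w_def by (cases "act \<gamma> f") (auto simp: act_swap simp del: act.simps)
  have "max (p^2 + q^2) (r^2 + s^2) * \<bar>Disc f\<bar> \<le> 54 * (12 * m)^4"
  proof (cases "r^2 + s^2 \<le> p^2 + q^2")
    case True
    then show ?thesis using act_proper_aux[OF g assms True] by (simp add: max_def)
  next
    case False
    then show ?thesis using act_proper_aux[OF e _ fb fbw] by (simp add: max_def det_mul dw assms(1))
  qed
  moreover have "(\<gamma>$i$j)^2 \<le> max (p^2 + q^2) (r^2 + s^2)"
    using exhaust_2[of i] exhaust_2[of j] by (auto simp: g le_max_iff_disj)
  ultimately show ?thesis by (meson abs_ge_zero mult_right_mono order_trans)
qed

section \<open>Irreducibility and multiplicity of models\<close>

text \<open>The leading coefficient in the outer variable \<open>Y\<close> is the nonzero constant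
  \<open>d\<close>, a unit of the coefficient ring. Hence every factor has a unit as leading
  coefficient, and a nonunit factor of degree at most 1 is linear in \<open>Y\<close> with a root
  that is a polynomial in \<open>X\<close>.\<close>

lemma root_of_low_degree_factor:
  fixes a b c d :: rat
  assumes d: "d \<noteq> 0" and pq: "form_poly (a, b, c, d) = p * q" and nu: "\<not> p dvd 1" and deg: "degree p \<le> 1"
  shows "\<exists>m. a + b * m + c * m^2 + d * m^3 = 0"
proof -
  let ?f = "form_poly (a, b, c, d)"
  have degf: "degree ?f = 3" and lcf: "lead_coeff ?f = [:d:]" using d by (simp_all add: numeral_3_eq_3)
  have lc: "lead_coeff p * lead_coeff q = [:d:]" using lcf unfolding pq lead_coeff_mult .
  have "[:d:] dvd 1" using d by (simp add: is_unit_const_poly_iff dvd_field_iff)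
  then have u: "lead_coeff p dvd 1" using lc by (metis dvd_trans dvd_triv_left)
  have "degree p \<noteq> 0"
  proof
    assume "degree p = 0"
    then obtain r where r: "p = [:r:]" by (metis degree_eq_zeroE)
    then show False using u nu by (simp add: is_unit_const_poly_iff)
  qed
  then have "degree p = 1" using deg by simp
  then obtain p0 p1 where p: "p = [:p0, p1:]" "p1 \<noteq> 0" by (metis One_nat_def degree1_coeffs)
  then have "p1 dvd 1" using u by simp
  then obtain e where e: "p1 = [:e:]" by (rule is_unit_polyE)
  then have e0: "e \<noteq> 0" using p(2) by auto
  define g where "g = smult (- 1 / e) p0"
  have "poly p g = 0" using e e0 by (simp add: p g_def)
  then have "poly ?f g = 0" unfolding pq by (simp only: poly_mult mult_zero_left)
  \<comment> \<open>Setting \<open>X = 1\<close> turns the polynomial root into a rational root of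
    the dehomogenized cubic.\<close>
  then have "poly (poly ?f g) 1 = 0" by simp
  then have "a + b * poly g 1 + c * (poly g 1)^2 + d * (poly g 1)^3 = 0"
    by (simp add: algebra_simps power2_eq_square power3_eq_cube)
  then show ?thesis by blast
qed

text \<open>The degrees in \<open>Y\<close> of two nonunit factors add up to 3, so one of them is at
  most 1.\<close>

lemma reducible_form_root:
  fixes a b c d :: rat
  assumes d: "d \<noteq> 0" and nirr: "\<not> irreducible (form_poly (a, b, c, d))"
  shows "\<exists>m. a + b * m + c * m^2 + d * m^3 = 0"
proof -
  let ?f = "form_poly (a, b, c, d)"
  have degf: "degree ?f = 3" using d by (simp add: numeral_3_eq_3)
  then have "?f \<noteq> 0" by force
  moreover have "\<not> ?f dvd 1"
  proof
    assume "?f dvd 1"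
    then obtain e where "?f = [:e:]" by (rule is_unit_polyE)
    then have "degree ?f = 0" by (simp only: degree_pCons_0)
    then show False using degf by simp
  qed
  ultimately obtain p q where pq: "?f = p * q" "\<not> p dvd 1" "\<not> q dvd 1"
    using nirr unfolding irreducible_def by blast
  have "degree p + degree q = 3" using degf \<open>?f \<noteq> 0\<close> unfolding pq by (subst (asm) degree_mult_eq) auto
  then have "degree p \<le> 1 \<or> degree q \<le> 1" by linarith
  then show ?thesis using root_of_low_degree_factor[OF d] pq by (metis mult.commute)
qed

text \<open>The parity conditions say that the form is nonzero at the three points of the projective
  line over the field with two elements: its values there are \<open>a\<close>, \<open>d\<close> and
  \<open>a + b + c + d\<close>. A rational root in lowest terms would reduce to a zero at one of
  them.\<close>

lemma odd_form_irreducible: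
  fixes a b c d :: int
  assumes "odd a" "odd d" "odd (b + c)"
  shows "irreducible (form_poly (map_form rat_of_int (a, b, c, d)))"
proof (rule ccontr)
  assume "\<not> ?thesis"
  moreover have "rat_of_int d \<noteq> 0" using assms(2) by (metis even_zero of_int_eq_0_iff)
  ultimately obtain m where m: "of_int a + of_int b * m + of_int c * m^2 + of_int d * m^3 = (0::rat)"
    using reducible_form_root by fastforce
  obtain x y where xy: "m = Fract x y" "y > 0" "coprime x y" by (metis Rat_cases)
  have my: "m * of_int y = of_int x" using xy by (simp add: Fract_of_int_quotient)
  have "(of_int a + of_int b * m + of_int c * m^2 + of_int d * m^3) * of_int y^3
     = (of_int (a * y^3 + b * x * y^2 + c * x^2 * y + d * x^3) :: rat)"
    by (simp add: my[symmetric] algebra_simps power2_eq_square power3_eq_cube)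
  then have "a * y^3 + b * x * y^2 + c * x^2 * y + d * x^3 = 0" using m by (simp only: of_int_eq_0_iff mult_zero_left)
  then have "even (a * y^3 + b * x * y^2 + c * x^2 * y + d * x^3)" by simp
  moreover have "\<not> (even x \<and> even y)" using xy(3) by (metis coprime_common_divisor_int odd_one abs_1 even_abs_add_iff coprime_def)
  ultimately show False using assms by auto
qed

section \<open>How many solutions share one model\<close>

lemma card_le_fibres:
  assumes "finite A" "\<And>x. x \<in> A \<Longrightarrow> card {y \<in> A. h y = h x} \<le> K"
  shows "card A \<le> K * card (h ` A)"
proof -
  have "A = (\<Union>z\<in>h ` A. {y \<in> A. h y = z})" by blast
  then have "card A \<le> (\<Sum>z\<in>h ` A. card {y \<in> A. h y = z})" using card_UN_le[of "h ` A"] assms(1) by (metis (no_types) finite_imageI)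
  also have "\<dots> \<le> of_nat (card (h ` A)) * K" using assms(2) by (intro sum_bounded_above) auto
  finally show ?thesis by (simp add: mult.commute)
qed

text \<open>Integral matrices are coded by quadruples, so that a bound on the entries becomes a box
  in \<open>int \<times> int \<times> int \<times> int\<close> whose points can be counted.\<close>

definition mat_of :: "int \<times> int \<times> int \<times> int \<Rightarrow> real^2^2" where
  "mat_of = (\<lambda>(p, q, r, s). vector [vector [of_int p, of_int q], vector [of_int r, of_int s]])"

lemma SL2_Z_mat_of:
  assumes "\<gamma> \<in> SL2_Z" obtains p q r s where "\<gamma> = mat_of (p, q, r, s)" "p * s - q * r = 1"
proof -
  have ent: "\<gamma>$i$j \<in> \<int>" for i j using assms by (simp add: SL2_Z_def)
  obtain p where p: "\<gamma>$1$1 = of_int p" using ent[of 1 1] by (rule Ints_cases)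
  obtain q where q: "\<gamma>$1$2 = of_int q" using ent[of 1 2] by (rule Ints_cases)
  obtain r where r: "\<gamma>$2$1 = of_int r" using ent[of 2 1] by (rule Ints_cases)
  obtain s where s: "\<gamma>$2$2 = of_int s" using ent[of 2 2] by (rule Ints_cases)
  have "real_of_int (p * s - q * r) = 1" using assms by (simp add: SL2_Z_def det_2 p q r s)
  then have "p * s - q * r = 1" by (simp only: of_int_eq_1_iff)
  moreover have "\<gamma> = mat_of (p, q, r, s)" by (simp add: mat_of_def vec_eq_iff forall_2 p q r s)
  ultimately show thesis using that by blast
qed

lemma SL2_Z_mult: "M \<in> SL2_Z \<Longrightarrow> N \<in> SL2_Z \<Longrightarrow> M ** N \<in> SL2_Z"
  unfolding SL2_Z_def mem_Collect_eq det_mul by (simp add: matrix_matrix_mult_def sum_2)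

lemma SL2_Z_inverse:
  assumes "M \<in> SL2_Z" obtains N where "N \<in> SL2_Z" "N ** M = mat 1" "M ** N = mat 1"
proof -
  obtain p q r s where M: "M = mat_of (p, q, r, s)" and det: "p * s - q * r = 1" using SL2_Z_mat_of[OF assms] .
  define N where "N = mat_of (s, - q, - r, p)"
  have det': "real_of_int p * of_int s - of_int q * of_int r = 1" using det by (metis of_int_1 of_int_diff of_int_mult)
  have "N \<in> SL2_Z" using det' by (simp add: SL2_Z_def N_def mat_of_def forall_2 det_2 mult.commute)
  moreover have "N ** M = mat 1" "M ** N = mat 1"
    using det' by (simp_all add: N_def M mat_of_def vec_eq_iff forall_2 matrix_matrix_mult_def sum_2 mat_def algebra_simps)
  ultimately show thesis using that by blast
qed

lemma act_mat_1: "act (mat 1) f = f"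
  by (cases f) (simp add: act_mat)

definition integral_solution :: "real cubic_form \<Rightarrow> int \<times> int \<Rightarrow> bool" where
  "integral_solution f P \<longleftrightarrow> f \<in> range (map_form real_of_int) \<and> coprime (fst P) (snd P) \<and>
     form_eval f (of_int (fst P)) (of_int (snd P)) = 1"

text \<open>The completion of \<open>P\<close> and the translation normalizing the second
  coefficient are merged into one matrix \<open>N\<close>. Its first row is still \<open>P\<close>,
  because \<open>n_mat\<close> changes the second row only.\<close>

lemma integral_solution_normal_form:
  assumes "integral_solution f P"
  obtains N u A B where "N \<in> SL2_Z" "N$1 = vector [of_int (fst P), of_int (snd P)]"
    "act N f = (1, of_int u, of_int A, of_int B)" "weierstrass_model f P = (u, A, B)"
proof -
  obtain M u k A B where M: "completes P M" "u \<in> {0, 1, 2}"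
    "act (n_mat (of_int k) ** M) f = (1, of_int u, of_int A, of_int B)"
    using model_exists[of f P] assms unfolding integral_solution_def by metis
  have "n_mat (of_int k) \<in> SL2_Z" by (simp add: SL2_Z_def forall_2 n_mat_def det_2)
  then have "n_mat (of_int k) ** M \<in> SL2_Z" using M(1) by (simp add: completes_def SL2_Z_mult)
  moreover have "(n_mat (of_int k) ** M)$1 = vector [of_int (fst P), of_int (snd P)]"
    using M(1) by (simp add: completes_def vec_eq_iff forall_2 matrix_matrix_mult_def sum_2 n_mat_def)
  ultimately show thesis using that M(3) model_eqI[OF M] by blast
qed

text \<open>Equal models mean that \<open>act N f = act N' f'\<close> for the two normalizing
  matrices, so the inverse of \<open>N'\<close> times \<open>N\<close> carries \<open>f\<close> to
  \<open>f'\<close>. Comparing first rows shows that the row vector \<open>P\<close> is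
  \<open>P'\<close> times this matrix; inverting it gives the formula for \<open>P'\<close>. The
  matrix thus determines the second pair.\<close>

lemma same_model_equivalent:
  assumes "integral_solution f P" "integral_solution f' P'" "weierstrass_model f P = weierstrass_model f' P'"
  obtains p q r s where "p * s - q * r = 1" "f' = act (mat_of (p, q, r, s)) f"
    "P' = (fst P * s - snd P * r, snd P * p - fst P * q)"
proof -
  obtain N u A B where N: "N \<in> SL2_Z" "N$1 = vector [of_int (fst P), of_int (snd P)]"
    "act N f = (1, of_int u, of_int A, of_int B)" "weierstrass_model f P = (u, A, B)"
    using integral_solution_normal_form[OF assms(1)] .
  obtain N' u' A' B' where N': "N' \<in> SL2_Z" "N'$1 = vector [of_int (fst P'), of_int (snd P')]"
    "act N' f' = (1, of_int u', of_int A', of_int B')" "weierstrass_model f' P' = (u', A', B')"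
    using integral_solution_normal_form[OF assms(2)] .
  have eq: "act N' f' = act N f" using N N' assms(3) by simp
  obtain N1 where N1: "N1 \<in> SL2_Z" "N1 ** N' = mat 1" "N' ** N1 = mat 1" using SL2_Z_inverse[OF N'(1)] .
  have "N1 ** N \<in> SL2_Z" using N1 N by (simp add: SL2_Z_mult)
  then obtain p q r s where g: "N1 ** N = mat_of (p, q, r, s)" and det: "p * s - q * r = 1" using SL2_Z_mat_of by blast
  have f': "f' = act (mat_of (p, q, r, s)) f"
    unfolding g[symmetric] act_mult eq[symmetric] by (simp add: N1 act_mat_1 flip: act_mult)
  have NN: "N' ** mat_of (p, q, r, s) = N" unfolding g[symmetric] matrix_mul_assoc N1 by simp
  have "N$1$j = (\<Sum>i\<in>UNIV. N'$1$i * mat_of (p, q, r, s)$i$j)" for j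
    unfolding NN[symmetric] by (simp add: matrix_matrix_mult_def)
  then have e: "N$1$j = N'$1$1 * mat_of (p, q, r, s)$1$j + N'$1$2 * mat_of (p, q, r, s)$2$j" for j
    by (simp add: sum_2)
  have "real_of_int (fst P) = of_int (fst P' * p + snd P' * r)" "real_of_int (snd P) = of_int (fst P' * q + snd P' * s)"
    using e[of 1] e[of 2] by (simp_all add: N(2) N'(2) mat_of_def)
  then have PP: "fst P = fst P' * p + snd P' * r" "snd P = fst P' * q + snd P' * s" by (simp_all only: of_int_eq_iff)
  have "fst P * s - snd P * r = fst P'" "snd P * p - fst P * q = snd P'"
    unfolding PP using det by algebra+
  then have "P' = (fst P * s - snd P * r, snd P * p - fst P * q)" by simp
  then show thesis using that det f' by blast
qed

text \<open>Pairs with the same model are related by an integral matrix of determinant 1 moving one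
  bounded form to another. By \<open>act_proper\<close> and the lower bound on the discriminant its
  entries lie between \<open>- b\<close> and \<open>b\<close>, which leaves
  \<open>(2 * b + 1)^4\<close> matrices.\<close>

lemma card_solutions_le_models:
  fixes b :: nat
  assumes fin: "finite W" and sol: "\<And>f P. (f, P) \<in> W \<Longrightarrow> integral_solution f P"
    and bd: "\<And>f P. (f, P) \<in> W \<Longrightarrow> form_bounded m f"
    and disc: "\<And>f P. (f, P) \<in> W \<Longrightarrow> 54 * (12 * m)^4 \<le> (of_nat b)^2 * \<bar>Disc f\<bar> \<and> Disc f \<noteq> 0"
  shows "card W \<le> (2 * b + 1)^4 * card ((\<lambda>(f, P). weierstrass_model f P) ` W)"
proof (rule card_le_fibres[OF fin])
  fix x assume x: "x \<in> W"
  obtain f P where fP: "x = (f, P)" by (cases x) metis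
  define I where "I = {- int b..int b}"
  have cI: "card I = 2 * b + 1" unfolding I_def by simp
  \<comment> \<open>\<open>h\<close> rebuilds the second pair from the matrix alone, so the fibre
    through \<open>(f, P)\<close> lies in the image of a box.\<close>
  define h where "h = (\<lambda>(p, q, r, s). (act (mat_of (p, q, r, s)) f, (fst P * s - snd P * r, snd P * p - fst P * q)))"
  have "{y \<in> W. (case y of (f, P) \<Rightarrow> weierstrass_model f P) = (case x of (f, P) \<Rightarrow> weierstrass_model f P)}
     \<subseteq> h ` (I \<times> I \<times> I \<times> I)"
  proof clarify
    fix f' \<alpha>' \<beta>' assume y: "(f', \<alpha>', \<beta>') \<in> W"
      and "weierstrass_model f' (\<alpha>', \<beta>') = (case x of (f, P) \<Rightarrow> weierstrass_model f P)"
    then have eq: "weierstrass_model f P = weierstrass_model f' (\<alpha>', \<beta>')" by (simp add: fP)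
    have xW: "(f, P) \<in> W" using x fP by simp
    obtain p q r s where g: "p * s - q * r = 1" "f' = act (mat_of (p, q, r, s)) f"
      "(\<alpha>', \<beta>') = (fst P * s - snd P * r, snd P * p - fst P * q)"
      by (rule same_model_equivalent[OF sol[OF xW] sol[OF y] eq])
    let ?g = "mat_of (p, q, r, s)"
    have "det ?g = of_int (p * s - q * r)" by (simp add: mat_of_def det_2)
    then have det: "det ?g = 1" using g(1) by simp
    have ent: "(?g$i$j)^2 \<le> (of_nat b)^2" for i j
    proof -
      have "(?g$i$j)^2 * \<bar>Disc f\<bar> \<le> 54 * (12 * m)^4"
        using act_proper[OF det bd[OF xW]] bd[OF y] g(2) by simp
      also have "\<dots> \<le> (of_nat b)^2 * \<bar>Disc f\<bar>" using disc[OF xW] by blast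
      finally show ?thesis using disc[OF xW] by (simp add: mult_le_cancel_right_pos)
    qed
    have I: "z \<in> I" if "(real_of_int z)^2 \<le> (of_nat b)^2" for z
    proof -
      have "\<bar>real_of_int z\<bar> \<le> \<bar>of_nat b\<bar>" using that by (rule abs_le_square_iff[THEN iffD2])
      then show ?thesis by (auto simp: I_def)
    qed
    have "p \<in> I" "q \<in> I" "r \<in> I" "s \<in> I"
      using ent[of 1 1] ent[of 1 2] ent[of 2 1] ent[of 2 2] by (auto intro!: I simp: mat_of_def)
    then show "(f', \<alpha>', \<beta>') \<in> h ` (I \<times> I \<times> I \<times> I)"
      using g(2,3) by (intro image_eqI[of _ _ "(p, q, r, s)"]) (simp_all add: h_def)
  qed
  then have "card {y \<in> W. (case y of (f, P) \<Rightarrow> weierstrass_model f P) = (case x of (f, P) \<Rightarrow> weierstrass_model f P)}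
     \<le> card (h ` (I \<times> I \<times> I \<times> I))" by (rule card_mono[rotated]) (simp add: I_def)
  also have "\<dots> \<le> card (I \<times> I \<times> I \<times> I)" by (rule card_image_le) (simp add: I_def)
  also have "\<dots> = (2 * b + 1)^4" by (simp add: card_cartesian_product cI power4_eq_xxxx)
  finally show "card {y \<in> W. (case y of (f, P) \<Rightarrow> weierstrass_model f P) = (case x of (f, P) \<Rightarrow> weierstrass_model f P)} \<le> (2 * b + 1)^4" .
qed

section \<open>Interior points of the fundamental domain\<close>

text \<open>The action without the twist is polynomial in the matrix, which makes it easy to differentiate.\<close>

fun subst_form :: "real^2^2 \<Rightarrow> real cubic_form \<Rightarrow> real cubic_form" where
  "subst_form g (a, b, c, d) =
    (a * (g$1$1)^3 + b * (g$1$1)^2 * g$1$2 + c * g$1$1 * (g$1$2)^2 + d * (g$1$2)^3,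
     3 * a * (g$1$1)^2 * g$2$1 + b * ((g$1$1)^2 * g$2$2 + 2 * g$1$1 * g$1$2 * g$2$1) +
       c * (2 * g$1$1 * g$1$2 * g$2$2 + (g$1$2)^2 * g$2$1) + 3 * d * (g$1$2)^2 * g$2$2,
     3 * a * g$1$1 * (g$2$1)^2 + b * (2 * g$1$1 * g$2$1 * g$2$2 + g$1$2 * (g$2$1)^2) +
       c * (g$1$1 * (g$2$2)^2 + 2 * g$1$2 * g$2$1 * g$2$2) + 3 * d * g$1$2 * (g$2$2)^2,
     a * (g$2$1)^3 + b * (g$2$1)^2 * g$2$2 + c * g$2$1 * (g$2$2)^2 + d * (g$2$2)^3)"

lemma act_eq_subst_form: "act g f = map_form (\<lambda>x. x / det g) (subst_form g f)"
  by (cases f) (simp only: act.simps subst_form.simps Let_def)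

lemma act_eq_subst_form_det_1: "det g = 1 \<Longrightarrow> act g f = subst_form g f"
  unfolding act_eq_subst_form by (cases "subst_form g f") simp

text \<open>A scalar acts by multiplying the form, so the extra factor \<open>mat (det g)\<close>
  undoes the division by the determinant in the twisted action.\<close>

lemma subst_form_eq_act:
  assumes "det g \<noteq> 0" shows "subst_form g f = act (g ** mat (det g)) f"
proof -
  obtain a b c d where f: "f = (a, b, c, d)" by (cases f)
  have "act (g ** mat (det g)) f = act g (det g * a, det g * b, det g * c, det g * d)"
    using assms by (simp add: act_mult f act_mat)
  also have "\<dots> = subst_form g f"
    unfolding act_eq_subst_form f subst_form.simps map_form.simps using assms by (simp add: field_simps)
  finally show ?thesis ..
qed

lemma has_derivative_entry: "((\<lambda>g::real^2^2. g$i$j) has_derivative (\<lambda>A. A$i$j)) F"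
  by (intro bounded_linear_imp_has_derivative bounded_linear_compose[OF bounded_linear_vec_nth bounded_linear_vec_nth])

lemma continuous_on_subst_form: "continuous_on S (\<lambda>g. subst_form g f)"
  by (cases f) (auto intro!: continuous_intros)

text \<open>This is the infinitesimal action of the 2 by 2 matrices on cubic forms, the part of
  \<open>subst_form\<close> that is linear in the deviation from the identity.\<close>

lemma has_derivative_subst_form:
  "((\<lambda>g. subst_form g (a, b, c, d)) has_derivative
    (\<lambda>A. (3 * a * A$1$1 + b * A$1$2,
          2 * b * A$1$1 + 2 * c * A$1$2 + 3 * a * A$2$1 + b * A$2$2,
          c * A$1$1 + 3 * d * A$1$2 + 2 * b * A$2$1 + 2 * c * A$2$2,
          c * A$2$1 + 3 * d * A$2$2))) (at (mat 1))"
  unfolding subst_form.simps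
  by (intro has_derivative_Pair)
    (auto intro!: derivative_eq_intros has_derivative_entry simp: mat_def algebra_simps)

text \<open>The infinitesimal action is a linear map between spaces of dimension 4 with determinant
  \<open>3 * Disc f\<close>. It is invertible for nonzero discriminant, and the open mapping theorem
  for a map with right-invertible derivative applies.\<close>

lemma subst_form_open:
  assumes D: "Disc f \<noteq> 0" and e: "e > 0"
  shows "f \<in> interior ((\<lambda>g. subst_form g f) ` ball (mat 1) e)"
proof -
  obtain a b c d where f: "f = (a, b, c, d)" by (cases f)
  define D where "D = 3 * Disc f"
  have D0: "D \<noteq> 0" using D by (simp add: D_def)
  have Deq: "D = 54*a*b*c*d - 12*a*c*c*c - 81*a*a*d*d - 12*b*b*b*d + 3*b*b*c*c"
    by (simp add: D_def f Disc.simps power2_eq_square power3_eq_cube)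
  \<comment> \<open>The inverse by Cramer's rule: the cubic polynomials in the numerators are the
    entries of the adjugate matrix, and \<open>D\<close> is the determinant.\<close>
  define R :: "real cubic_form \<Rightarrow> real^2^2" where "R = (\<lambda>(x, y, z, w). vector
    [vector [((15*b*c*d - 4*c*c*c - 27*a*d*d)*x + (2*b*c*c - 6*b*b*d)*y + (9*a*b*d - b*b*c)*z + (2*b*b*b - 6*a*b*c)*w) / D,
             ((3*b*c*c - 12*b*b*d + 9*a*c*d)*x + (18*a*b*d - 6*a*c*c)*y + (3*a*b*c - 27*a*a*d)*z + (18*a*a*c - 6*a*b*b)*w) / D],
     vector [((18*b*d*d - 6*c*c*d)*x + (3*b*c*d - 27*a*d*d)*y + (18*a*c*d - 6*b*b*d)*z + (9*a*b*d - 12*a*c*c + 3*b*b*c)*w) / D,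
             ((2*c*c*c - 6*b*c*d)*x + (9*a*c*d - b*c*c)*y + (2*b*b*c - 6*a*c*c)*z + (15*a*b*c - 27*a*a*d - 4*b*b*b)*w) / D]])"
  have "linear R"
    by (intro linearI) (auto simp: R_def vec_eq_iff forall_2 split_beta algebra_simps add_divide_distrib diff_divide_distrib)
  then have bl: "bounded_linear R" by (simp add: linear_conv_bounded_linear)
  have inv: "(\<lambda>A::real^2^2. (3 * a * A$1$1 + b * A$1$2,
          2 * b * A$1$1 + 2 * c * A$1$2 + 3 * a * A$2$1 + b * A$2$2,
          c * A$1$1 + 3 * d * A$1$2 + 2 * b * A$2$1 + 2 * c * A$2$2,
          c * A$2$1 + 3 * d * A$2$2)) \<circ> R = id"
  proof
    fix h :: "real cubic_form"
    obtain x y z w where h: "h = (x, y, z, w)" by (cases h)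
    have R: "R h $1$1 * D = (15*b*c*d - 4*c*c*c - 27*a*d*d)*x + (2*b*c*c - 6*b*b*d)*y + (9*a*b*d - b*b*c)*z + (2*b*b*b - 6*a*b*c)*w"
      "R h $1$2 * D = (3*b*c*c - 12*b*b*d + 9*a*c*d)*x + (18*a*b*d - 6*a*c*c)*y + (3*a*b*c - 27*a*a*d)*z + (18*a*a*c - 6*a*b*b)*w"
      "R h $2$1 * D = (18*b*d*d - 6*c*c*d)*x + (3*b*c*d - 27*a*d*d)*y + (18*a*c*d - 6*b*b*d)*z + (9*a*b*d - 12*a*c*c + 3*b*b*c)*w"
      "R h $2$2 * D = (2*c*c*c - 6*b*c*d)*x + (9*a*c*d - b*c*c)*y + (2*b*b*c - 6*a*c*c)*z + (15*a*b*c - 27*a*a*d - 4*b*b*b)*w"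
      using D0 by (simp_all add: R_def h)
    define p q r s where pq: "p = R h $1$1" "q = R h $1$2" "r = R h $2$1" "s = R h $2$2"
    have "(3 * a * p + b * q) * D = x * D" "(2 * b * p + 2 * c * q + 3 * a * r + b * s) * D = y * D"
      "(c * p + 3 * d * q + 2 * b * r + 2 * c * s) * D = z * D" "(c * r + 3 * d * s) * D = w * D"
      using R Deq unfolding pq[symmetric] by algebra+
    then show "((\<lambda>A::real^2^2. (3 * a * A$1$1 + b * A$1$2,
          2 * b * A$1$1 + 2 * c * A$1$2 + 3 * a * A$2$1 + b * A$2$2,
          c * A$1$1 + 3 * d * A$1$2 + 2 * b * A$2$1 + 2 * c * A$2$2,
          c * A$2$1 + 3 * d * A$2$2)) \<circ> R) h = id h"
      using D0 by (simp add: pq h)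
  qed
  have "subst_form (mat 1) f \<in> interior ((\<lambda>g. subst_form g f) ` ball (mat 1) e)"
    by (rule sussmann_open_mapping[OF open_UNIV continuous_on_subst_form UNIV_I has_derivative_subst_form[of a b c d, folded f] bl inv subset_UNIV])
      (use e in simp)
  moreover have "subst_form (mat 1) f = f" by (simp add: f mat_def)
  ultimately show ?thesis by simp
qed

section \<open>Recognizing matrices of the Gauss domain\<close>

lemma rotation_matrix_2:
  fixes x y :: real
  assumes "x^2 + y^2 = 1" shows "rotation_matrix (vector [vector [x, y], vector [-y, x]] :: real^2^2)"
  using assms unfolding rotation_matrix_def orthogonal_matrix
  by (simp add: det_2 vec_eq_iff forall_2 matrix_matrix_mult_def sum_2 transpose_def mat_def power2_eq_square)

lemma mat_commute: "mat l ** A = A ** mat l" for A :: "real^2^2"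
  by (simp add: vec_eq_iff forall_2 matrix_matrix_mult_def sum_2 mat_def)

lemma mat_mult_mat: "mat l ** mat m = (mat (l * m) :: real^2^2)"
  by (simp add: vec_eq_iff forall_2 matrix_matrix_mult_def sum_2 mat_def)

lemma gauss_domain_mult:
  assumes g: "g \<in> gauss_domain \<nu>" and k: "rotation_matrix k" and l: "l > 0"
  shows "g ** mat l ** k \<in> gauss_domain \<nu>"
proof -
  obtain u t k' l' where h: "g = n_mat u ** a_mat t ** k' ** mat l'" "u \<in> \<nu> t" "t \<ge> t0" "rotation_matrix k'" "l' > 0"
    using g unfolding gauss_domain_def by blast
  have "g ** mat l ** k = n_mat u ** a_mat t ** k' ** (mat (l' * l) ** k)"
    unfolding h(1) mat_mult_mat[symmetric] by (simp only: matrix_mul_assoc)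
  then have "g ** mat l ** k = n_mat u ** a_mat t ** (k' ** k) ** mat (l' * l)"
    unfolding mat_commute[of _ k] by (simp only: matrix_mul_assoc)
  moreover have "rotation_matrix (k' ** k)"
    using h(4) k by (simp add: rotation_matrix_def orthogonal_matrix_mul det_mul)
  ultimately show ?thesis using h l unfolding gauss_domain_def by (blast intro: mult_pos_pos)
qed

text \<open>In Iwasawa coordinates \<open>l^2\<close> is the determinant, \<open>t\<close> is
  \<open>l\<close> divided by the length \<open>R\<close> of the first row, and \<open>u\<close> is
  the inner product of the rows divided by \<open>R^2\<close>. The second part of the hypothesis
  labelled \<open>R\<close> says \<open>t \<ge> 1\<close>; there \<open>\<nu> t\<close> is the whole
  interval, and the last hypothesis is \<open>\<bar>u\<bar> \<le> 1/2\<close>.\<close>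

lemma gauss_domain_iwasawa:
  assumes \<nu>: "gauss_fibre \<nu>" and h: "h$1$1 = p" "h$1$2 = q" "h$2$1 = r" "h$2$2 = s"
    and R: "0 < p^2 + q^2" "p^2 + q^2 \<le> p * s - q * r" and u: "2 * \<bar>p * r + q * s\<bar> \<le> p^2 + q^2"
  shows "h \<in> gauss_domain \<nu>"
proof -
  define R where "R = sqrt (p^2 + q^2)"
  define l where "l = sqrt (p * s - q * r)"
  define t where "t = l / R"
  define u where "u = (p * r + q * s) / R^2"
  define k :: "real^2^2" where "k = vector [vector [p / R, q / R], vector [- (q / R), p / R]]"
  have R2: "R^2 = p^2 + q^2" and R0: "R > 0" using R by (auto simp: R_def)
  have l2: "l^2 = p * s - q * r" and l0: "l > 0" using R by (auto simp: l_def)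
  have "R \<le> l" using R by (simp add: R_def l_def)
  then have t1: "t \<ge> 1" using R0 by (simp add: t_def)
  have "(p / R)^2 + (q / R)^2 = (p^2 + q^2) / R^2" by (simp add: power_divide add_divide_distrib)
  also have "\<dots> = 1" unfolding R2[symmetric] using R0 by simp
  finally have k: "rotation_matrix k" unfolding k_def by (rule rotation_matrix_2)
  have e1: "r * R^2 = (p * r + q * s) * p - q * l^2" "s * R^2 = (p * r + q * s) * q + p * l^2"
    unfolding R2 l2 by algebra+
  have "u * p - q / R * t * l = ((p * r + q * s) * p - q * l^2) / R^2"
    by (simp add: u_def t_def power2_eq_square diff_divide_distrib)
  then have e2: "r = u * p - q / R * t * l" unfolding e1(1)[symmetric] using R0 by simp
  have "u * q + p / R * t * l = ((p * r + q * s) * q + p * l^2) / R^2"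
    by (simp add: u_def t_def power2_eq_square add_divide_distrib distrib_right)
  then have e3: "s = u * q + p / R * t * l" unfolding e1(2)[symmetric] using R0 by simp
  have tl: "inverse t * (p / R) * l = p" "inverse t * (q / R) * l = q" using R0 l0 by (simp_all add: t_def)
  have "n_mat u ** a_mat t ** k ** mat l =
      vector [vector [inverse t * (p / R) * l, inverse t * (q / R) * l],
      vector [u * (inverse t * (p / R) * l) - q / R * t * l, u * (inverse t * (q / R) * l) + p / R * t * l]]"
    by (simp add: vec_eq_iff forall_2 matrix_matrix_mult_def sum_2 n_mat_def a_mat_def k_def mat_def algebra_simps)
  also have "\<dots> = h" unfolding tl e2[symmetric] e3[symmetric] by (simp add: vec_eq_iff forall_2 h)
  finally have "h = n_mat u ** a_mat t ** k ** mat l" ..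
  moreover have "u \<in> \<nu> t"
  proof -
    have "\<bar>u\<bar> \<le> 1/2" using u R0 by (simp add: u_def abs_divide R2[symmetric] field_simps)
    then show ?thesis using \<nu> t1 unfolding gauss_fibre_def by (auto simp: abs_le_iff)
  qed
  moreover have "t \<ge> t0" using t1 t0_le_1 by simp
  ultimately show ?thesis using k l0 unfolding gauss_domain_def by blast
qed

text \<open>The point \<open>t = 2\<close>, \<open>u = 0\<close> lies strictly inside the region
  \<open>t \<ge> 1\<close>, \<open>\<bar>u\<bar> \<le> 1/2\<close>. Matrices near the identity,
  multiplied from the left, keep it there, and by \<open>subst_form_open\<close> they sweep out a
  neighbourhood of the form.\<close>

lemma gauss_orbit_interior:
  assumes \<nu>: "gauss_fibre \<nu>" and D: "Disc v \<noteq> 0" and k: "rotation_matrix k"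
  shows "act (a_mat 2 ** k) v \<in> interior ((\<lambda>g. act g v) ` gauss_domain \<nu>)"
proof -
  define w where "w = act (a_mat 2 ** k) v"
  have "Disc w \<noteq> 0" unfolding w_def using D
    by (subst Disc_act) (simp_all add: det_mul det_a_mat rotation_det[OF k])
  then have "w \<in> interior ((\<lambda>g. subst_form g w) ` ball (mat 1) (1/100))" by (rule subst_form_open) simp
  moreover have "(\<lambda>g. subst_form g w) ` ball (mat 1) (1/100) \<subseteq> (\<lambda>g. act g v) ` gauss_domain \<nu>"
  proof (rule image_subsetI)
    fix g :: "real^2^2" assume "g \<in> ball (mat 1) (1/100)"
    then have n: "norm (g - mat 1) < 1/100" by (simp add: dist_norm norm_minus_commute)
    define e where "e = g - mat 1"
    have e: "\<bar>e$i$j\<bar> \<le> 1/100" for i j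
      using component_le_norm_cart[of "e $ i" j] Finite_Cartesian_Product.norm_nth_le[of e i] n unfolding e_def by linarith
    have g: "g$1$1 = 1 + e$1$1" "g$1$2 = e$1$2" "g$2$1 = e$2$1" "g$2$2 = 1 + e$2$2" by (simp_all add: e_def mat_def)
    have ee: "\<bar>e$i$j * e$i'$j'\<bar> \<le> 1/100 * (1/100)" for i j i' j'
      unfolding abs_mult using e by (intro mult_mono) auto
    have det: "det g = 1 + e$1$1 + e$2$2 + e$1$1 * e$2$2 - e$1$2 * e$2$1" by (simp add: det_2 g algebra_simps)
    have det0: "det g > 9/10" unfolding det using ee[of 1 1 2 2] ee[of 1 2 2 1] e[of 1 1] e[of 2 2] by linarith
    \<comment> \<open>The first row is close to \<open>(1/2, 0)\<close> and the determinant is close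
      to 1. The radius \<open>1/100\<close> leaves ample room in the inequalities of
      \<open>gauss_domain_iwasawa\<close>.\<close>
    have H: "(g ** a_mat 2)$1$1 = (1 + e$1$1) / 2" "(g ** a_mat 2)$1$2 = 2 * e$1$2"
      "(g ** a_mat 2)$2$1 = e$2$1 / 2" "(g ** a_mat 2)$2$2 = 2 * (1 + e$2$2)"
      by (simp_all add: matrix_matrix_mult_def sum_2 a_mat_def g)
    have sq: "((1 + e$1$1) / 2)^2 + (2 * e$1$2)^2 = 1/4 + e$1$1 / 2 + (e$1$1 * e$1$1) / 4 + 4 * (e$1$2 * e$1$2)"
      by (simp add: power2_eq_square field_simps)
    have "g ** a_mat 2 \<in> gauss_domain \<nu>"
    proof (rule gauss_domain_iwasawa[OF \<nu> H])
      show "0 < ((1 + e$1$1) / 2)^2 + (2 * e$1$2)^2" unfolding sq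
        using ee[of 1 1 1 1] ee[of 1 2 1 2] e[of 1 1] by linarith
      have "(1 + e$1$1) / 2 * (2 * (1 + e$2$2)) - 2 * e$1$2 * (e$2$1 / 2) = det g" unfolding det by (simp add: field_simps)
      then show "((1 + e$1$1) / 2)^2 + (2 * e$1$2)^2 \<le> (1 + e$1$1) / 2 * (2 * (1 + e$2$2)) - 2 * e$1$2 * (e$2$1 / 2)"
        unfolding sq using ee[of 1 1 1 1] ee[of 1 2 1 2] e[of 1 1] det0 by linarith
      have inner: "(1 + e$1$1) / 2 * (e$2$1 / 2) + 2 * e$1$2 * (2 * (1 + e$2$2)) =
        e$2$1 / 4 + (e$1$1 * e$2$1) / 4 + 4 * e$1$2 + 4 * (e$1$2 * e$2$2)" by (simp add: field_simps)
      have "\<bar>e$2$1 / 4 + (e$1$1 * e$2$1) / 4 + 4 * e$1$2 + 4 * (e$1$2 * e$2$2)\<bar> \<le> 1/10"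
        by (rule abs_leI) (use ee[of 1 1 2 1] ee[of 1 2 2 2] e[of 2 1] e[of 1 2] in linarith)+
      moreover have "1/5 \<le> ((1 + e$1$1) / 2)^2 + (2 * e$1$2)^2"
        unfolding sq using ee[of 1 1 1 1] ee[of 1 2 1 2] e[of 1 1] by linarith
      ultimately show "2 * \<bar>(1 + e$1$1) / 2 * (e$2$1 / 2) + 2 * e$1$2 * (2 * (1 + e$2$2))\<bar> \<le> ((1 + e$1$1) / 2)^2 + (2 * e$1$2)^2"
        unfolding inner by simp
    qed
    then have "g ** a_mat 2 ** mat (det g) ** k \<in> gauss_domain \<nu>" using det0 k by (intro gauss_domain_mult) auto
    \<comment> \<open>The scalar that removes the twist is central; moved to the right, it is
      absorbed together with the rotation \<open>k\<close> by
      \<open>gauss_domain_mult\<close>.\<close>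
    moreover have "g ** mat (det g) ** a_mat 2 = g ** a_mat 2 ** mat (det g)"
      using mat_commute[of "det g" "a_mat 2"] by (simp flip: matrix_mul_assoc)
    then have "subst_form g w = act (g ** a_mat 2 ** mat (det g) ** k) v"
      using det0 unfolding w_def by (subst subst_form_eq_act) (auto simp: matrix_mul_assoc simp flip: act_mult)
    ultimately show "subst_form g w \<in> (\<lambda>g. act g v) ` gauss_domain \<nu>" by blast
  qed
  ultimately show ?thesis unfolding w_def using interior_mono by blast
qed

section \<open>Interior forms vanishing at a prescribed point\<close>

text \<open>The degree is odd, so the values at opposite points of the circle have opposite signs
  and the intermediate value theorem applies.\<close>

lemma cubic_form_real_root:
  fixes v :: "real cubic_form"
  obtains \<phi> where "form_eval v (cos \<phi>) (sin \<phi>) = 0"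
proof -
  obtain a b c d where v: "v = (a, b, c, d)" by (cases v)
  define h where "h = (\<lambda>t. form_eval v (cos t) (sin t))"
  have "continuous_on {0..pi} h" unfolding h_def v form_eval.simps by (intro continuous_intros)
  moreover have "h pi = - h 0" by (simp add: h_def v)
  ultimately have "\<exists>t. h t = 0"
    using IVT'[of h 0 0 pi] IVT2'[of h pi 0 0] by (cases "h 0 \<le> 0") auto
  then show thesis using that by (auto simp: h_def)
qed

text \<open>With the row vector \<open>(x, y)\<close> read as the complex number
  \<open>x + iy\<close>, multiplication by \<open>rot z\<close> on the right is multiplication by
  \<open>cnj z\<close>.\<close>

definition rot :: "complex \<Rightarrow> real^2^2" where
  "rot z = vector [vector [Re z, - Im z], vector [Im z, Re z]]"

lemma rotation_matrix_rot: "norm z = 1 \<Longrightarrow> rotation_matrix (rot z)"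
  using rotation_matrix_2[of "Re z" "- Im z"] by (simp add: rot_def cmod_def)

lemma form_eval_subst_form:
  "form_eval (subst_form g f) x y = form_eval f (g$1$1 * x + g$2$1 * y) (g$1$2 * x + g$2$2 * y)"
proof -
  obtain a b c d where f: "f = (a, b, c, d)" by (cases f)
  show ?thesis unfolding f subst_form.simps form_eval.simps by algebra
qed

text \<open>The forms \<open>act (a_mat 2 ** rot z) v\<close> with \<open>z\<close> on the unit
  circle form a compact subset of the interior of the orbit. This gives one
  \<open>\<epsilon>\<close> and one \<open>m\<close> for all points, and a suitable rotation makes
  the form vanish at any given point.\<close>

lemma orbit_neighbourhood:
  assumes \<nu>: "gauss_fibre \<nu>" and D: "Disc v \<noteq> 0" and \<kappa>: "\<kappa>1 < \<bar>Disc v\<bar>" "\<bar>Disc v\<bar> < \<kappa>2"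
  obtains \<epsilon> m where "\<epsilon> > 0"
    "\<forall>\<alpha> \<beta>. \<alpha> \<noteq> 0 \<longrightarrow> (\<exists>f0. form_eval f0 \<alpha> \<beta> = 0 \<and> form_bounded m f0 \<and>
      (\<forall>f. dist f f0 < \<epsilon> \<longrightarrow> f \<in> (\<lambda>g. act g v) ` gauss_domain \<nu> \<and> \<kappa>1 < \<bar>Disc f\<bar> \<and> \<bar>Disc f\<bar> < \<kappa>2))"
proof -
  obtain a b c d where v: "v = (a, b, c, d)" by (cases v)
  define S where "S = (\<lambda>g. act g v) ` gauss_domain \<nu>"
  \<comment> \<open>\<open>subst_form\<close> is polynomial in the entries, so continuity is
    immediate; on the unit circle it agrees with \<open>act\<close> because \<open>rot z\<close> has
    determinant 1.\<close>
  define h where "h = (\<lambda>z. act (a_mat 2) (subst_form (rot z) v))"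
  define K where "K = h ` sphere 0 1"
  have "continuous_on (sphere 0 1) h"
    unfolding h_def v subst_form.simps by (auto simp: rot_def act_a_mat intro!: continuous_intros)
  then have comp: "compact K" unfolding K_def by (intro compact_continuous_image) auto
  have hact: "h z = act (a_mat 2 ** rot z) v" if "norm z = 1" for z
    using rotation_matrix_rot[OF that] by (simp add: h_def act_mult act_eq_subst_form_det_1[of "rot z"] rotation_det)
  have "continuous_on UNIV (\<lambda>(a, b, c, d). Disc (a, b, c, d))"
    unfolding Disc.simps split_beta by (intro continuous_intros)
  then have cD: "continuous_on UNIV Disc" by simp
  have "open {x::real. \<kappa>1 < \<bar>x\<bar> \<and> \<bar>x\<bar> < \<kappa>2}"
    by (intro open_Collect_conj open_Collect_less continuous_intros)
  then have "open (Disc -` {x. \<kappa>1 < \<bar>x\<bar> \<and> \<bar>x\<bar> < \<kappa>2})" using cD by (rule open_vimage)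
  then have opn: "open (interior S \<inter> Disc -` {x. \<kappa>1 < \<bar>x\<bar> \<and> \<bar>x\<bar> < \<kappa>2})" by (intro open_Int open_interior)
  have "K \<subseteq> interior S \<inter> Disc -` {x. \<kappa>1 < \<bar>x\<bar> \<and> \<bar>x\<bar> < \<kappa>2}"
  proof
    fix f assume "f \<in> K"
    then obtain z where z: "norm z = 1" "f = act (a_mat 2 ** rot z) v" by (auto simp: K_def hact)
    note k = rotation_matrix_rot[OF z(1)]
    have "Disc f = Disc v" unfolding z by (subst Disc_act) (simp_all add: det_mul det_a_mat rotation_det[OF k])
    then show "f \<in> interior S \<inter> Disc -` {x. \<kappa>1 < \<bar>x\<bar> \<and> \<bar>x\<bar> < \<kappa>2}"
      using gauss_orbit_interior[OF \<nu> D k] \<kappa> by (simp add: S_def z)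
  qed
  then obtain \<epsilon> where e: "\<epsilon> > 0" "(\<Union>x\<in>K. ball x \<epsilon>) \<subseteq> interior S \<inter> Disc -` {x. \<kappa>1 < \<bar>x\<bar> \<and> \<bar>x\<bar> < \<kappa>2}"
    by (rule compact_subset_open_imp_ball_epsilon_subset[OF comp opn])
  obtain m where m: "\<And>f. f \<in> K \<Longrightarrow> norm f \<le> m" using compact_imp_bounded[OF comp] by (auto simp: bounded_iff)
  obtain \<phi> where \<phi>: "form_eval v (cos \<phi>) (sin \<phi>) = 0" by (rule cubic_form_real_root)
  show thesis
  proof (rule that[OF e(1)], intro allI impI)
    fix \<alpha> \<beta> :: real assume "\<alpha> \<noteq> 0"
    \<comment> \<open>\<open>w\<close> is the point \<open>(\<alpha>, \<beta>)\<close> after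
      multiplication by \<open>a_mat 2\<close>. The unit number \<open>z\<close> is then chosen so
      that \<open>w * cnj z\<close> points in the direction \<open>\<phi>\<close>, where
      \<open>v\<close> vanishes.\<close>
    define w where "w = Complex (\<alpha> / 2) (2 * \<beta>)"
    define z where "z = w * cnj (cis \<phi>) / norm w"
    have w0: "w \<noteq> 0" using \<open>\<alpha> \<noteq> 0\<close> by (simp add: w_def complex_eq_iff)
    have z: "norm z = 1" using w0 by (simp add: z_def norm_mult norm_divide)
    define f0 where "f0 = h z"
    have fK: "f0 \<in> K" using z by (simp add: f0_def K_def)
    have "w * cnj z = norm w * cis \<phi>"
      using w0 by (simp add: z_def field_simps complex_norm_square[symmetric] power2_eq_square)
    then have rt: "Re w * Re z + Im w * Im z = norm w * cos \<phi>" "Im w * Re z - Re w * Im z = norm w * sin \<phi>"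
      by (auto simp: complex_eq_iff)
    obtain a1 b1 c1 d1 where s: "subst_form (rot z) v = (a1, b1, c1, d1)" by (metis prod_cases4)
    have "form_eval f0 \<alpha> \<beta> = form_eval (subst_form (rot z) v) (\<alpha> / 2) (2 * \<beta>)"
      unfolding f0_def h_def s by (simp add: act_a_mat power2_eq_square power3_eq_cube)
    also have "\<dots> = form_eval v (norm w * cos \<phi>) (norm w * sin \<phi>)"
      unfolding form_eval_subst_form rt[symmetric] by (simp add: rot_def w_def algebra_simps)
    also have "\<dots> = (norm w)^3 * form_eval v (cos \<phi>) (sin \<phi>)"
      by (simp add: v power_mult_distrib power2_eq_square power3_eq_cube algebra_simps)
    finally have "form_eval f0 \<alpha> \<beta> = 0" by (simp add: \<phi>)
    moreover have "form_bounded m f0"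
    proof -
      obtain p q r s where f0: "f0 = (p, q, r, s)" by (cases f0)
      have "norm f0 \<le> m" using m fK .
      then show ?thesis unfolding f0
        using norm_fst_le[of p "(q, r, s)"] norm_snd_le[of "(q, r, s)" p] norm_fst_le[of q "(r, s)"] norm_snd_le[of "(r, s)" q]
          norm_fst_le[of r s] norm_snd_le[of s r] by simp
    qed
    moreover have "\<forall>f. dist f f0 < \<epsilon> \<longrightarrow> f \<in> (\<lambda>g. act g v) ` gauss_domain \<nu> \<and> \<kappa>1 < \<bar>Disc f\<bar> \<and> \<bar>Disc f\<bar> < \<kappa>2"
    proof (intro allI impI)
      fix f assume "dist f f0 < \<epsilon>"
      then have "f \<in> interior S \<inter> Disc -` {x. \<kappa>1 < \<bar>x\<bar> \<and> \<bar>x\<bar> < \<kappa>2}"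
        using fK by (intro subsetD[OF e(2)] UN_I[of f0]) (simp_all add: dist_commute)
      then show "f \<in> (\<lambda>g. act g v) ` gauss_domain \<nu> \<and> \<kappa>1 < \<bar>Disc f\<bar> \<and> \<bar>Disc f\<bar> < \<kappa>2"
        using interior_subset[of S] by (auto simp: S_def)
    qed
    ultimately show "\<exists>f0. form_eval f0 \<alpha> \<beta> = 0 \<and> form_bounded m f0 \<and>
      (\<forall>f. dist f f0 < \<epsilon> \<longrightarrow> f \<in> (\<lambda>g. act g v) ` gauss_domain \<nu> \<and> \<kappa>1 < \<bar>Disc f\<bar> \<and> \<bar>Disc f\<bar> < \<kappa>2)" by blast
  qed
qed

section \<open>Counting integral solutions\<close>

lemma card_residue_class:
  fixes S :: "int set" and n :: int
  assumes n: "n \<noteq> 0" and B: "\<And>x. x \<in> S \<Longrightarrow> \<bar>of_int x\<bar> \<le> B" and cong: "\<And>x y. x \<in> S \<Longrightarrow> y \<in> S \<Longrightarrow> n dvd x - y"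
    and "0 \<le> B"
  shows "finite S" "real (card S) \<le> 2 * B / \<bar>of_int n\<bar> + 1"
proof -
  have "S \<subseteq> {-\<lfloor>B\<rfloor>..\<lfloor>B\<rfloor>}" using B by (auto simp: abs_le_iff le_floor_iff) (metis B abs_le_iff le_floor_iff minus_le_iff of_int_minus)
  then show fin: "finite S" by (rule finite_subset) simp
  show "real (card S) \<le> 2 * B / \<bar>of_int n\<bar> + 1"
  proof (cases "S = {}")
    case False
    define x0 where "x0 = Min S"
    define K where "K = \<lfloor>2 * B / \<bar>of_int n\<bar>\<rfloor>"
    have x0: "x0 \<in> S" using fin False by (simp add: x0_def)
    have K0: "K \<ge> 0" using \<open>0 \<le> B\<close> by (simp add: K_def)
    have "S \<subseteq> (\<lambda>k. x0 + \<bar>n\<bar> * k) ` {0..K}"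
    proof
      fix x assume x: "x \<in> S"
      have "\<bar>n\<bar> dvd x - x0" using cong[OF x x0] by simp
      then obtain k where k: "x - x0 = \<bar>n\<bar> * k" by (auto simp: dvd_def)
      have "x0 \<le> x" using x fin by (simp add: x0_def)
      then have "0 \<le> \<bar>n\<bar> * k" using k by linarith
      then have k0: "0 \<le> k" using n by (simp add: zero_le_mult_iff)
      have "real_of_int (\<bar>n\<bar> * k) = of_int x - of_int x0" by (simp only: k[symmetric] of_int_diff)
      also have "\<dots> \<le> 2 * B" using B[OF x] B[OF x0] by linarith
      finally have "real_of_int k \<le> 2 * B / \<bar>of_int n\<bar>" using n by (simp add: field_simps)
      then have "k \<le> K" by (simp add: K_def le_floor_iff)
      then show "x \<in> (\<lambda>k. x0 + \<bar>n\<bar> * k) ` {0..K}" using k k0 by (intro image_eqI[of _ _ k]) auto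
    qed
    then have "card S \<le> card {0..K}" by (rule surj_card_le[rotated]) simp
    then have "real (card S) \<le> of_int K + 1" using K0 by simp
    also have "of_int K \<le> 2 * B / \<bar>of_int n\<bar>" by (simp add: K_def)
    finally show ?thesis by simp
  qed (use \<open>0 \<le> B\<close> in simp)
qed

section \<open>Counting in residue classes\<close>

text \<open>Each term is at most the telescoping difference
  \<open>2 * sqrt (J + 1) - 2 * sqrt J\<close>, which amounts to
  \<open>2 * sqrt (J * (J + 1)) \<le> 2 * J + 1\<close>.\<close>

lemma sum_inverse_sqrt: "(\<Sum>j=1..J. 1 / sqrt (real j)) \<le> 2 * sqrt (real J)"
proof (induction J)
  case (Suc J)
  have "(2 * (real J + 1) - 1)^2 \<ge> (2 * sqrt (real J * (real J + 1)))^2"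
    by (simp add: power_mult_distrib power2_eq_square algebra_simps)
  then have "2 * sqrt (real J * (real J + 1)) \<le> 2 * (real J + 1) - 1" by (rule power2_le_imp_le) simp
  then have "2 * sqrt (real J) * sqrt (real J + 1) + 1 \<le> 2 * (sqrt (real J + 1) * sqrt (real J + 1))"
    by (simp add: real_sqrt_mult)
  moreover have "1 / s \<le> 2 * s - 2 * t" if "2 * t * s + 1 \<le> 2 * (s * s)" "0 < s" for s t :: real
    using that by (subst pos_divide_le_eq) (auto simp: algebra_simps)
  ultimately have "1 / sqrt (real J + 1) \<le> 2 * sqrt (real J + 1) - 2 * sqrt (real J)"
    by fastforce
  then show ?case using Suc by (simp add: add.commute)
qed simp

text \<open>Distinct elements have distinct indices \<open>h x\<close> and satisfy
  \<open>x \<ge> 1 + n * h x\<close>. The index 0 contributes at most 1, and the others are compared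
  with the sum of \<open>1 / sqrt (n * j)\<close>.\<close>

lemma sum_inverse_sqrt_residue_class_pos:
  fixes S :: "int set" and n :: int
  assumes n: "n > 0" and A: "\<And>x. x \<in> S \<Longrightarrow> of_int x \<le> A" and pos: "\<And>x. x \<in> S \<Longrightarrow> 0 < x"
    and cong: "\<And>x y. x \<in> S \<Longrightarrow> y \<in> S \<Longrightarrow> n dvd x - y" and A0: "0 \<le> A"
  shows "(\<Sum>x\<in>S. 1 / sqrt (of_int x)) \<le> 1 + 2 * sqrt A / of_int n"
proof (cases "S = {}")
  case False
  have absA: "\<bar>of_int x\<bar> \<le> A" if "x \<in> S" for x using A[OF that] pos[OF that] by simp
  have fin: "finite S" using n by (intro card_residue_class(1)[OF _ absA cong A0]) auto
  define J where "J = nat \<lfloor>A / of_int n\<rfloor>"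
  define g where "g = (\<lambda>j::nat. 1 / sqrt (1 + of_int n * real j))"
  \<comment> \<open>The shift by 1 also treats multiples of \<open>n\<close> correctly and keeps the
    comparison value at index 0 equal to 1 instead of \<open>1 / sqrt 0\<close>.\<close>
  define h where "h = (\<lambda>x. nat ((x - 1) div n))"
  have inj: "inj_on h S"
  proof (rule inj_onI)
    fix x y assume x: "x \<in> S" and y: "y \<in> S" and "h x = h y"
    moreover have "0 \<le> (x - 1) div n" "0 \<le> (y - 1) div n"
      using n pos[OF x] pos[OF y] by (simp_all add: pos_imp_zdiv_nonneg_iff)
    ultimately have "(x - 1) div n = (y - 1) div n" by (simp only: h_def eq_nat_nat_iff)
    moreover have "(x - 1) mod n = (y - 1) mod n" using cong[OF x y] by (simp add: mod_eq_dvd_iff)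
    ultimately show "x = y" by (metis diff_add_cancel mult_div_mod_eq)
  qed
  have le: "1 + of_int n * real (h x) \<le> of_int x" if x: "x \<in> S" for x
  proof -
    have "n * ((x - 1) div n) \<le> x - 1" using n by (metis mult_div_mod_eq pos_mod_sign le_add_same_cancel1)
    moreover have "real (h x) = of_int ((x - 1) div n)" using n pos[OF x] by (simp add: h_def pos_imp_zdiv_nonneg_iff)
    ultimately have "of_int n * real (h x) \<le> of_int (x - 1)" by (simp only: of_int_le_iff flip: of_int_mult)
    then show ?thesis by simp
  qed
  have sub: "h ` S \<subseteq> {0..J}"
  proof clarify
    fix x assume x: "x \<in> S"
    have "real (h x) \<le> A / of_int n" using le[OF x] A[OF x] n by (simp add: field_simps)
    then have "int (h x) \<le> \<lfloor>A / of_int n\<rfloor>" by (simp add: le_floor_iff)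
    then show "h x \<in> {0..J}" by (simp add: J_def)
  qed
  have "(\<Sum>x\<in>S. 1 / sqrt (of_int x)) \<le> (\<Sum>x\<in>S. g (h x))"
    unfolding g_def using le n by (intro sum_mono divide_left_mono mult_pos_pos) (auto simp: pos intro!: add_pos_nonneg)
  also have "\<dots> = sum g (h ` S)" by (simp add: sum.reindex[OF inj])
  also have "\<dots> \<le> sum g {0..J}" using n by (intro sum_mono2 sub) (auto simp: g_def)
  also have "\<dots> = 1 + sum g {1..J}" by (simp add: sum.atLeast_Suc_atMost g_def)
  also have "sum g {1..J} \<le> (\<Sum>j=1..J. 1 / sqrt (of_int n) * (1 / sqrt (real j)))"
  proof (rule sum_mono)
    fix j assume "j \<in> {1..J}"
    then have "0 < of_int n * real j" using n by simp
    then have "g j \<le> 1 / sqrt (of_int n * real j)"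
      unfolding g_def by (intro divide_left_mono mult_pos_pos) auto
    then show "g j \<le> 1 / sqrt (of_int n) * (1 / sqrt (real j))" by (simp add: real_sqrt_mult)
  qed
  also have "\<dots> \<le> 1 / sqrt (of_int n) * (2 * sqrt (real J))"
    unfolding sum_distrib_left[symmetric] using n by (intro mult_left_mono sum_inverse_sqrt) auto
  also have "\<dots> \<le> 1 / sqrt (of_int n) * (2 * sqrt (A / of_int n))"
    using n A0 by (intro mult_left_mono) (auto simp: J_def)
  also have "\<dots> = 2 * sqrt A / of_int n" using n by (simp add: real_sqrt_divide)
  finally show ?thesis by simp
qed (use n A0 in simp)

lemma sum_inverse_sqrt_residue_class:
  fixes S :: "int set" and n :: int
  assumes n: "n \<noteq> 0" and A: "\<And>x. x \<in> S \<Longrightarrow> \<bar>of_int x\<bar> \<le> A" and nz: "0 \<notin> S"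
    and cong: "\<And>x y. x \<in> S \<Longrightarrow> y \<in> S \<Longrightarrow> n dvd x - y" and A0: "0 \<le> A"
  shows "(\<Sum>x\<in>S. 1 / sqrt \<bar>of_int x\<bar>) \<le> 2 + 4 * sqrt A / \<bar>of_int n\<bar>"
proof -
  have fin: "finite S" using card_residue_class(1)[OF n A cong A0] .
  define P where "P = {x \<in> S. x > 0}"
  define N where "N = {x \<in> S. x < 0}"
  have S: "S = P \<union> N" and disj: "P \<inter> N = {}" using nz by (auto simp: P_def N_def not_less order_le_less)
  have "(\<Sum>x\<in>S. 1 / sqrt \<bar>of_int x\<bar>) = (\<Sum>x\<in>P. 1 / sqrt \<bar>of_int x\<bar>) + (\<Sum>x\<in>N. 1 / sqrt \<bar>of_int x\<bar>)"
    unfolding S using fin disj by (intro sum.union_disjoint) (auto simp: P_def N_def)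
  also have "(\<Sum>x\<in>P. 1 / sqrt \<bar>of_int x\<bar>) = (\<Sum>x\<in>P. 1 / sqrt (of_int x))"
    by (intro sum.cong) (auto simp: P_def)
  also have "\<dots> \<le> 1 + 2 * sqrt A / of_int \<bar>n\<bar>"
    using n A cong A0 by (intro sum_inverse_sqrt_residue_class_pos) (force simp: P_def)+
  also have "(\<Sum>x\<in>N. 1 / sqrt \<bar>of_int x\<bar>) = (\<Sum>x\<in>uminus ` N. 1 / sqrt (of_int x))"
    by (subst sum.reindex) (auto simp: N_def inj_on_def intro!: sum.cong)
  also have "\<dots> \<le> 1 + 2 * sqrt A / of_int \<bar>n\<bar>"
  proof (intro sum_inverse_sqrt_residue_class_pos)
    fix x y assume "x \<in> uminus ` N" "y \<in> uminus ` N"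
    then have "n dvd (- y) - (- x)" by (intro cong) (auto simp: N_def)
    then show "\<bar>n\<bar> dvd x - y" by simp
  qed (use n A A0 in \<open>force simp: N_def\<close>)+
  finally show ?thesis by simp
qed

text \<open>The difference of the two equations is read modulo successive powers of
  \<open>\<beta>\<close>: once the leading differences vanish, a power of \<open>\<beta>\<close>
  cancels, and the next difference times a power of \<open>\<alpha>\<close> is divisible by
  \<open>\<beta>\<close>, to which \<open>\<alpha>\<close> is coprime.\<close>

lemma form_fibre_cong:
  fixes \<alpha> \<beta> :: int
  assumes cop: "coprime \<alpha> \<beta>" and b0: "\<beta> \<noteq> 0"
    and eq: "form_eval (a, b, c, d) \<alpha> \<beta> = form_eval (a', b', c', d') \<alpha> \<beta>"
  shows "\<beta> dvd a - a'" and "a = a' \<Longrightarrow> \<beta> dvd b - b'" and "a = a' \<Longrightarrow> b = b' \<Longrightarrow> \<beta> dvd c - c'"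
    and "a = a' \<Longrightarrow> b = b' \<Longrightarrow> c = c' \<Longrightarrow> d = d'"
proof -
  have c3: "coprime \<beta> (\<alpha>^3)" "coprime \<beta> (\<alpha>^2)" "coprime \<beta> \<alpha>" using cop by (simp_all add: coprime_commute)
  have E: "(a - a') * \<alpha>^3 + (b - b') * \<alpha>^2 * \<beta> + (c - c') * \<alpha> * \<beta>^2 + (d - d') * \<beta>^3 = 0"
    using eq by (simp add: algebra_simps)
  have "(a - a') * \<alpha>^3 = \<beta> * (- (b - b') * \<alpha>^2 - (c - c') * \<alpha> * \<beta> - (d - d') * \<beta>^2)"
    using E by algebra
  then have "\<beta> dvd (a - a') * \<alpha>^3" by (metis dvd_triv_left)
  then show "\<beta> dvd a - a'" using c3(1) by (simp add: coprime_dvd_mult_left_iff)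
  show "\<beta> dvd b - b'" if "a = a'"
  proof -
    have "\<beta> * ((b - b') * \<alpha>^2 + \<beta> * ((c - c') * \<alpha> + (d - d') * \<beta>)) = 0" using E that by algebra
    then have "(b - b') * \<alpha>^2 + \<beta> * ((c - c') * \<alpha> + (d - d') * \<beta>) = 0" using b0 by (metis mult_eq_0_iff)
    then have "(b - b') * \<alpha>^2 = \<beta> * (- (c - c') * \<alpha> - (d - d') * \<beta>)" by algebra
    then have "\<beta> dvd (b - b') * \<alpha>^2" by (metis dvd_triv_left)
    then show ?thesis using c3(2) by (simp add: coprime_dvd_mult_left_iff)
  qed
  show "\<beta> dvd c - c'" if "a = a'" "b = b'"
  proof -
    have "\<beta>^2 * ((c - c') * \<alpha> + (d - d') * \<beta>) = 0" using E that by algebra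
    then have "(c - c') * \<alpha> + (d - d') * \<beta> = 0" using b0 by (metis mult_eq_0_iff power_eq_0_iff)
    then have "(c - c') * \<alpha> = \<beta> * (d' - d)" by algebra
    then have "\<beta> dvd (c - c') * \<alpha>" by (metis dvd_triv_left)
    then show ?thesis using c3(3) by (simp add: coprime_dvd_mult_left_iff)
  qed
  show "d = d'" if "a = a'" "b = b'" "c = c'" using E that b0 by simp
qed

text \<open>The count is fibred over \<open>a\<close>, then \<open>b\<close>, then \<open>c\<close>,
  each confined to one residue class modulo \<open>\<beta>\<close>, with \<open>d\<close> determined
  at the end. The conditions \<open>Y \<le> B\<close> and \<open>Y * sqrt A \<le> E\<close> make the
  ranges of \<open>b\<close> and \<open>c\<close> long enough for the extra 1 in the class count to
  be absorbed, at a factor 3 each.\<close>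

lemma cusp_forms_card:
  fixes \<alpha> \<beta> :: int and A B E Y :: real
  assumes cop: "coprime \<alpha> \<beta>" and Y: "1 \<le> Y" "Y \<le> \<bar>of_int \<beta>\<bar>"
    and A: "0 \<le> A" and B: "Y \<le> B" and E: "Y * sqrt A \<le> E" "0 \<le> E"
  defines "Z \<equiv> {(a, b, c, d). form_eval (a, b, c, d) \<alpha> \<beta> = 1 \<and> a \<noteq> 0 \<and> \<bar>of_int a\<bar> \<le> A \<and>
    \<bar>of_int b\<bar> \<le> B \<and> \<bar>of_int c\<bar> \<le> E / sqrt \<bar>of_int a\<bar>}"
  shows "finite Z" "real (card Z) \<le> 9 * B * E / Y^2 * (2 + 4 * sqrt A / Y)"
proof -
  have b0: "\<beta> \<noteq> 0" using Y by auto
  note cong = form_fibre_cong[OF cop b0]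
  define SA where "SA = {a. a \<noteq> 0 \<and> \<bar>of_int a\<bar> \<le> A \<and> (\<exists>b c d. form_eval (a, b, c, d) \<alpha> \<beta> = 1)}"
  define SB where "SB = (\<lambda>a. {b. \<bar>of_int b\<bar> \<le> B \<and> (\<exists>c d. form_eval (a, b, c, d) \<alpha> \<beta> = 1)})"
  define SC where "SC = (\<lambda>a b. {c. \<bar>of_int c\<bar> \<le> E / sqrt \<bar>of_int a\<bar> \<and> (\<exists>d. form_eval (a, b, c, d) \<alpha> \<beta> = 1)})"
  have congA: "\<beta> dvd x - y" if "x \<in> SA" "y \<in> SA" for x y using that cong(1) unfolding SA_def mem_Collect_eq by metis
  have congB: "\<beta> dvd x - y" if "x \<in> SB a" "y \<in> SB a" for x y a using that cong(2) unfolding SB_def mem_Collect_eq by metis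
  have congC: "\<beta> dvd x - y" if "x \<in> SC a b" "y \<in> SC a b" for x y a b using that cong(3) unfolding SC_def mem_Collect_eq by metis
  have finA: "finite SA" using congA A by (intro card_residue_class(1)[OF b0]) (auto simp: SA_def)
  have B0: "0 \<le> B" using Y B by linarith
  have finB: "finite (SB a)" for a
    by (rule card_residue_class(1)[OF b0 _ _ B0], simp add: SB_def, erule (1) congB)
  have cB: "real (card (SB a)) \<le> 2 * B / \<bar>of_int \<beta>\<bar> + 1" for a
    by (rule card_residue_class(2)[OF b0 _ _ B0], simp add: SB_def, erule (1) congB)
  have E0: "0 \<le> E / sqrt \<bar>of_int a\<bar>" for a using E by simp
  have finC: "finite (SC a b)" for a b
    by (rule card_residue_class(1)[OF b0 _ _ E0[of a]], simp add: SC_def, erule (1) congC)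
  have cC: "real (card (SC a b)) \<le> 2 * (E / sqrt \<bar>of_int a\<bar>) / \<bar>of_int \<beta>\<bar> + 1" for a b
    by (rule card_residue_class(2)[OF b0 _ _ E0[of a]], simp add: SC_def, erule (1) congC)
  have cB': "real (card (SB a)) \<le> 3 * B / Y" for a
  proof -
    define w z where "w = 2 * B / \<bar>of_int \<beta>\<bar>" and "z = B / Y"
    have "w \<le> 2 * B / Y" unfolding w_def using Y B0 by (intro divide_left_mono) auto
    then have "w \<le> 2 * z" by (simp add: z_def)
    moreover have "1 \<le> z" using Y B by (simp add: z_def)
    moreover have "real (card (SB a)) \<le> w + 1" using cB[of a] by (simp add: w_def)
    ultimately have "real (card (SB a)) \<le> 3 * z" by linarith
    then show ?thesis by (simp add: z_def)
  qed
  have cC': "real (card (SC a b)) \<le> 3 * E / Y * (1 / sqrt \<bar>of_int a\<bar>)" if "a \<in> SA" for a b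
  proof -
    define s where "s = sqrt \<bar>of_int a\<bar>"
    have "1 \<le> \<bar>real_of_int a\<bar>" using that by (auto simp: SA_def)
    then have s0: "s > 0" by (simp add: s_def)
    have "s \<le> sqrt A" using that by (simp add: s_def SA_def)
    then have "Y * s \<le> E" using E Y by (meson mult_left_mono order_trans zero_le_one)
    define w z where "w = 2 * (E / s) / \<bar>of_int \<beta>\<bar>" and "z = E / s / Y"
    have "1 \<le> z" using \<open>Y * s \<le> E\<close> s0 Y by (simp add: z_def field_simps)
    moreover have "w \<le> 2 * (E / s) / Y" unfolding w_def using Y E s0 by (intro divide_left_mono) auto
    then have "w \<le> 2 * z" by (simp add: z_def)
    moreover have "real (card (SC a b)) \<le> w + 1" using cC[of a b] by (simp add: w_def s_def)
    ultimately have "real (card (SC a b)) \<le> 3 * z" by linarith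
    then show ?thesis by (simp add: s_def z_def mult.commute)
  qed
  define h :: "int cubic_form \<Rightarrow> int \<times> int \<times> int" where "h = (\<lambda>(a, b, c, d). (a, b, c))"
  define U where "U = (SIGMA a:SA. SIGMA b:SB a. SC a b)"
  have finU: "finite U" unfolding U_def using finA finB finC by (intro finite_SigmaI) auto
  have sub: "h ` Z \<subseteq> U" by (auto simp: h_def Z_def U_def SA_def SB_def SC_def simp del: form_eval.simps)
  have inj: "inj_on h Z"
  proof (rule inj_onI)
    fix x y assume xy: "x \<in> Z" "y \<in> Z" "h x = h y"
    obtain a b c d a' b' c' d' where "x = (a, b, c, d)" "y = (a', b', c', d')" by (metis prod_cases4)
    then show "x = y" using xy cong(4)[of a b c d a' b' c' d']
      by (auto simp: h_def Z_def simp del: form_eval.simps)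
  qed
  show "finite Z" using inj finU sub by (meson finite_imageD finite_subset)
  have "card Z \<le> card U" using inj finU sub by (metis card_image card_mono)
  also have "card U = (\<Sum>a\<in>SA. \<Sum>b\<in>SB a. card (SC a b))" unfolding U_def using finA finB finC by simp
  finally have "real (card Z) \<le> (\<Sum>a\<in>SA. \<Sum>b\<in>SB a. real (card (SC a b)))" by (simp flip: of_nat_sum)
  also have "\<dots> \<le> (\<Sum>a\<in>SA. 3 * B / Y * (3 * E / Y * (1 / sqrt \<bar>of_int a\<bar>)))"
  proof (rule sum_mono)
    fix a assume a: "a \<in> SA"
    have "(\<Sum>b\<in>SB a. real (card (SC a b))) \<le> real (card (SB a)) * (3 * E / Y * (1 / sqrt \<bar>of_int a\<bar>))"
      using cC'[OF a] by (intro sum_bounded_above)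
    also have "\<dots> \<le> 3 * B / Y * (3 * E / Y * (1 / sqrt \<bar>of_int a\<bar>))"
      using cB' E Y by (intro mult_right_mono) auto
    finally show "(\<Sum>b\<in>SB a. real (card (SC a b))) \<le> 3 * B / Y * (3 * E / Y * (1 / sqrt \<bar>of_int a\<bar>))" .
  qed
  also have "\<dots> = 9 * B * E / Y^2 * (\<Sum>a\<in>SA. 1 / sqrt \<bar>of_int a\<bar>)"
    by (simp add: sum_distrib_left power2_eq_square mult.assoc)
  also have "\<dots> \<le> 9 * B * E / Y^2 * (2 + 4 * sqrt A / Y)"
  proof (rule mult_left_mono)
    have "(\<Sum>a\<in>SA. 1 / sqrt \<bar>of_int a\<bar>) \<le> 2 + 4 * sqrt A / \<bar>of_int \<beta>\<bar>"
      using congA A by (intro sum_inverse_sqrt_residue_class[OF b0]) (auto simp: SA_def)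
    also have "\<dots> \<le> 2 + 4 * sqrt A / Y" using Y A by (intro add_left_mono divide_left_mono) auto
    finally show "(\<Sum>a\<in>SA. 1 / sqrt \<bar>of_int a\<bar>) \<le> 2 + 4 * sqrt A / Y" .
  qed (use B0 E in auto)
  finally show "real (card Z) \<le> 9 * B * E / Y^2 * (2 + 4 * sqrt A / Y)" .
qed

section \<open>Irreducible integral solutions near a real form\<close>

text \<open>The form \<open>X^3 + X^2 Y + Y^3\<close> has the required parities, and its value at
  the point is odd, say \<open>2 * n + 1\<close>. Subtracting \<open>2 * n\<close> times
  \<open>x X^3 + y Y^3\<close>, which takes the value 1 there, corrects the value without changing
  any parity.\<close>

lemma odd_solution_exists:
  fixes \<alpha> \<beta> :: int
  assumes cop: "coprime \<alpha> \<beta>"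
  obtains a b c d where "odd a" "odd d" "odd (b + c)" "form_eval (a, b, c, d) \<alpha> \<beta> = 1"
proof -
  have "coprime (\<alpha>^3) (\<beta>^3)" using cop by simp
  then obtain x y where xy: "x * \<alpha>^3 + y * \<beta>^3 = 1" by (metis bezout_int coprime_imp_gcd_eq_1)
  have "\<not> (even \<alpha> \<and> even \<beta>)" using cop by (metis odd_one coprime_def)
  then have "odd (\<alpha>^3 + \<alpha>^2 * \<beta> + \<beta>^3)" by auto
  then obtain n where n: "\<alpha>^3 + \<alpha>^2 * \<beta> + \<beta>^3 = 2 * n + 1" by (rule oddE)
  have "form_eval (1 - 2 * n * x, 1, 0, 1 - 2 * n * y) \<alpha> \<beta> = 1"
    unfolding form_eval.simps using n xy by algebra
  then show thesis using that[of "1 - 2 * n * x" "1 - 2 * n * y" 1 0] by simp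
qed

lemma floor_offset:
  fixes x :: real and N j :: int
  assumes "0 \<le> j" "j < N" shows "\<bar>of_int (\<lfloor>x\<rfloor> + j) - x\<bar> \<le> of_int N"
  using assms by linarith

lemma floor_progression:
  fixes x y :: real and n j N :: int
  assumes "n \<noteq> 0" "0 \<le> j" "j < N"
  shows "\<bar>y + 2 * of_int n * of_int (\<lfloor>(x - y) / (2 * of_int n)\<rfloor> + j) - x\<bar> \<le> 2 * \<bar>of_int n\<bar> * of_int N"
proof -
  have "y + 2 * of_int n * of_int (\<lfloor>(x - y) / (2 * of_int n)\<rfloor> + j) - x =
    2 * of_int n * (of_int (\<lfloor>(x - y) / (2 * of_int n)\<rfloor> + j) - (x - y) / (2 * of_int n))"
    using assms(1) by (simp add: field_simps)
  then show ?thesis using floor_offset[OF assms(2,3), of "(x - y) / (2 * of_int n)"]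
    by (simp add: abs_mult mult_left_mono)
qed

text \<open>Adding twice the product of \<open>\<beta> X - \<alpha> Y\<close> and an integral
  quadratic form \<open>p X^2 + q X Y + r Y^2\<close> preserves both the value at the point and the
  parities. Letting \<open>p\<close>, \<open>q\<close>, \<open>r\<close> run through
  \<open>N\<close> consecutive integers each gives \<open>N^3\<close> forms.\<close>

lemma odd_forms_card:
  fixes \<alpha> \<beta> :: int and a0 b0 c0 d0 Y :: real and N :: nat
  assumes cop: "coprime \<alpha> \<beta>" and Y: "1 \<le> Y" "Y \<le> \<bar>of_int \<alpha>\<bar>" "\<bar>of_int \<alpha>\<bar> < 2 * Y" "Y \<le> \<bar>of_int \<beta>\<bar>" "\<bar>of_int \<beta>\<bar> < 2 * Y"
    and rt: "form_eval (a0, b0, c0, d0) (of_int \<alpha>) (of_int \<beta>) = 0"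
  defines "Z \<equiv> {(a, b, c, d). form_eval (a, b, c, d) \<alpha> \<beta> = 1 \<and> odd a \<and> odd d \<and> odd (b + c) \<and>
    \<bar>of_int a - a0\<bar> \<le> 60 * Y * N \<and> \<bar>of_int b - b0\<bar> \<le> 60 * Y * N \<and> \<bar>of_int c - c0\<bar> \<le> 60 * Y * N \<and> \<bar>of_int d - d0\<bar> \<le> 60 * Y * N}"
  shows "\<exists>W \<subseteq> Z. finite W \<and> card W = N^3"
proof -
  have n0: "\<beta> \<noteq> 0" using Y by auto
  obtain a1 b1 c1 d1 where f1: "odd a1" "odd d1" "odd (b1 + c1)" "form_eval (a1, b1, c1, d1) \<alpha> \<beta> = 1"
    using odd_solution_exists[OF cop] .
  \<comment> \<open>The floors choose the starting points so that \<open>a\<close>,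
    \<open>b\<close>, \<open>c\<close> come in turn within
    \<open>2 * \<bar>\<beta>\<bar> * N\<close> of their targets. Each later choice takes account of
    the shift caused by the preceding one.\<close>
  define p where "p = (\<lambda>i. \<lfloor>(a0 - of_int a1) / (2 * of_int \<beta>)\<rfloor> + i)"
  define q where "q = (\<lambda>i j. \<lfloor>(b0 - of_int (b1 - 2 * \<alpha> * p i)) / (2 * of_int \<beta>)\<rfloor> + j)"
  define r where "r = (\<lambda>i j k. \<lfloor>(c0 - of_int (c1 - 2 * \<alpha> * q i j)) / (2 * of_int \<beta>)\<rfloor> + k)"
  define h where "h = (\<lambda>(i, j, k). (a1 + 2 * \<beta> * p i, b1 - 2 * \<alpha> * p i + 2 * \<beta> * q i j,
     c1 - 2 * \<alpha> * q i j + 2 * \<beta> * r i j k, d1 - 2 * \<alpha> * r i j k))"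
  define I where "I = {0..<int N}"
  have inj: "inj_on h (I \<times> I \<times> I)"
    by (rule inj_onI) (use n0 in \<open>auto simp: h_def p_def q_def r_def\<close>)
  have "h ` (I \<times> I \<times> I) \<subseteq> Z"
  proof (rule image_subsetI, clarify)
    fix i j k assume ijk: "i \<in> I" "j \<in> I" "k \<in> I"
    define a b c d where abcd: "a = a1 + 2 * \<beta> * p i" "b = b1 - 2 * \<alpha> * p i + 2 * \<beta> * q i j"
      "c = c1 - 2 * \<alpha> * q i j + 2 * \<beta> * r i j k" "d = d1 - 2 * \<alpha> * r i j k"
    have h: "h (i, j, k) = (a, b, c, d)" by (simp add: h_def abcd)
    have N1: "1 \<le> real N" using ijk by (auto simp: I_def)
    have ev: "form_eval (a, b, c, d) \<alpha> \<beta> = 1"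
      unfolding f1(4)[symmetric] form_eval.simps abcd by algebra
    have bd: "2 * \<bar>of_int \<beta>\<bar> * of_int (int N) \<le> 4 * (Y * N)"
    proof -
      have "2 * \<bar>real_of_int \<beta>\<bar> * N \<le> 2 * (2 * Y) * N" using Y by (intro mult_right_mono) auto
      then show ?thesis by simp
    qed
    have A: "\<bar>of_int a - a0\<bar> \<le> 4 * (Y * N)"
      using order_trans[OF floor_progression[OF n0, of i "int N" "of_int a1" a0] bd] ijk(1) unfolding abcd by (simp add: I_def p_def)
    have B: "\<bar>of_int b - b0\<bar> \<le> 4 * (Y * N)"
      using order_trans[OF floor_progression[OF n0, of j "int N" "of_int (b1 - 2 * \<alpha> * p i)" b0] bd] ijk(2) unfolding abcd by (simp add: I_def q_def)
    have C: "\<bar>of_int c - c0\<bar> \<le> 4 * (Y * N)"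
      using order_trans[OF floor_progression[OF n0, of k "int N" "of_int (c1 - 2 * \<alpha> * q i j)" c0] bd] ijk(3) unfolding abcd by (simp add: I_def r_def)
    \<comment> \<open>The real form vanishes at the point, so the error in \<open>d\<close> is
      expressed by the other three. Both coordinates lie between \<open>Y\<close> and
      \<open>2 * Y\<close>, hence \<open>\<bar>\<rho>\<bar> \<le> 2\<close>, and the total is at
      most \<open>1 + 4 * (8 + 4 + 2) = 57\<close> times \<open>Y * N\<close>.\<close>
    define \<rho> where "\<rho> = of_int \<alpha> / real_of_int \<beta>"
    have \<rho>: "\<bar>\<rho>\<bar> \<le> 2" using Y n0 by (simp add: \<rho>_def abs_divide field_simps)
    have \<alpha>: "of_int \<alpha> = \<rho> * of_int \<beta>" using n0 by (simp add: \<rho>_def)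
    have "real_of_int (form_eval (a, b, c, d) \<alpha> \<beta>) - form_eval (a0, b0, c0, d0) (of_int \<alpha>) (of_int \<beta>) = 1"
      using ev rt by (simp del: form_eval.simps)
    then have "((of_int a - a0) * \<rho>^3 + (of_int b - b0) * \<rho>^2 + (of_int c - c0) * \<rho> + (of_int d - d0)) * (of_int \<beta>)^3 = 1"
      unfolding form_eval.simps of_int_add of_int_mult of_int_power \<alpha> by (simp add: algebra_simps power2_eq_square power3_eq_cube)
    then have S: "of_int d - d0 = 1 / (of_int \<beta>)^3 - (of_int a - a0) * \<rho>^3 - (of_int b - b0) * \<rho>^2 - (of_int c - c0) * \<rho>"
      using n0 by (simp add: field_simps)
    have "1 \<le> \<bar>real_of_int \<beta>\<bar>^3" using Y by (intro one_le_power) linarith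
    then have e1: "\<bar>1 / (real_of_int \<beta>)^3\<bar> \<le> 1" using n0 by (simp add: power_abs divide_le_eq)
    have r2: "\<bar>\<rho>\<bar>^2 \<le> 2^2" "\<bar>\<rho>\<bar>^3 \<le> 2^3" using \<rho> by (intro power_mono; simp)+
    have YN: "0 \<le> Y * N" using Y by simp
    have e2: "\<bar>(of_int a - a0) * \<rho>^3\<bar> \<le> 4 * (Y * N) * 8" unfolding abs_mult power_abs using A r2 YN by (intro mult_mono) auto
    have e3: "\<bar>(of_int b - b0) * \<rho>^2\<bar> \<le> 4 * (Y * N) * 4" unfolding abs_mult power_abs using B r2 YN by (intro mult_mono) auto
    have e4: "\<bar>(of_int c - c0) * \<rho>\<bar> \<le> 4 * (Y * N) * 2" unfolding abs_mult using C \<rho> YN by (intro mult_mono) auto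
    have "1 * 1 \<le> Y * N" using Y N1 by (intro mult_mono) auto
    then have D: "\<bar>of_int d - d0\<bar> \<le> 60 * (Y * N)" using e1 e2 e3 e4 unfolding S by linarith
    have "odd a" "odd d" using f1 by (simp_all add: abcd)
    moreover have "odd (b + c)" using f1(3) by (simp add: abcd)
    ultimately show "h (i, j, k) \<in> Z" using ev A B C D YN unfolding h Z_def by (simp add: mult.assoc del: form_eval.simps)
  qed
  moreover have "card (h ` (I \<times> I \<times> I)) = N^3"
    unfolding card_image[OF inj] by (simp add: card_cartesian_product I_def power3_eq_cube)
  moreover have "finite (h ` (I \<times> I \<times> I))" by (simp add: I_def)
  ultimately show ?thesis by blast
qed

section \<open>Non-escape of mass\<close>

lemma finite_prim_box: "finite (prim_box Y)"
proof (rule finite_subset)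
  show "prim_box Y \<subseteq> {- \<lceil>2 * Y\<rceil>..\<lceil>2 * Y\<rceil>} \<times> {- \<lceil>2 * Y\<rceil>..\<lceil>2 * Y\<rceil>}"
  proof clarify
    fix \<alpha> \<beta> assume "(\<alpha>, \<beta>) \<in> prim_box Y"
    then have "\<bar>real_of_int \<alpha>\<bar> < 2 * Y" "\<bar>real_of_int \<beta>\<bar> < 2 * Y" by (auto simp: prim_box_def)
    then show "\<alpha> \<in> {- \<lceil>2 * Y\<rceil>..\<lceil>2 * Y\<rceil>} \<and> \<beta> \<in> {- \<lceil>2 * Y\<rceil>..\<lceil>2 * Y\<rceil>}" by (simp add: le_ceiling_iff) linarith
  qed
qed simp

lemma form_eval_map_form:
  "form_eval (map_form real_of_int f) (of_int x) (of_int y) = of_int (form_eval f x y)"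
  by (cases f) simp

text \<open>
  The parameter \<open>t\<close> is eliminated by \<open>t^2 |a| \<le> 12 m \<Lambda> / T\<close>; this is weaker than the true
  \<open>t^3 |a| \<le> 12 m \<Lambda>\<close> but leads to a sum of \<open>1 / sqrt |a|\<close>.
\<close>

lemma cusp_pairs_card_aux:
  fixes \<Lambda> T Y m X :: real
  assumes \<nu>: "gauss_fibre \<nu>" and v: "form_bounded m v" and D: "Disc v \<noteq> 0" and m: "m > 0" and \<Lambda>: "\<Lambda> > 0" and T: "T > 0"
    and Y: "2 \<le> Y" and X: "cp * X \<le> \<Lambda>^4 * \<bar>Disc v\<bar>"
    and le: "Y * T \<le> 48 * m * \<Lambda>" "Y \<le> 72 * m * \<Lambda> * T" "Y^2 \<le> 12 * m * \<Lambda> / T^3"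
  shows "finite (solution_pairs (gauss_cusp \<nu> T) v i cm cp X Y) \<and>
    real (card (solution_pairs (gauss_cusp \<nu> T) v i cm cp X Y)) \<le>
      real (card (prim_box Y)) * (2239488 * (m * \<Lambda> / (T * Y))^3)"
proof -
  define A where "A = 12 * m * \<Lambda> / T^3"
  define B where "B = 48 * m * \<Lambda> / T"
  \<comment> \<open>This is the bound \<open>72 * m * \<Lambda> * t\<close> for \<open>c\<close>
    with \<open>t\<close> replaced by its upper bound
    \<open>T * sqrt A / sqrt \<bar>a\<bar>\<close>; the factor \<open>1 / sqrt \<bar>a\<bar>\<close>
    is split off.\<close>
  define E where "E = 72 * m * \<Lambda> * T * sqrt A"
  define Z where "Z = (\<lambda>(\<alpha>, \<beta>). {(a, b, c, d). form_eval (a, b, c, d) \<alpha> \<beta> = 1 \<and> a \<noteq> 0 \<and> \<bar>of_int a\<bar> \<le> A \<and>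
    \<bar>of_int b\<bar> \<le> B \<and> \<bar>of_int c\<bar> \<le> E / sqrt \<bar>of_int a\<bar>})"
  have A0: "A > 0" using m \<Lambda> T by (simp add: A_def)
  have YA: "Y \<le> sqrt A" using le(3) by (intro real_le_rsqrt) (simp add: A_def)
  have YB: "Y \<le> B" using le(1) T by (simp add: B_def field_simps)
  have YE: "Y * sqrt A \<le> E" unfolding E_def using le(2) A0 by (intro mult_right_mono) auto
  have E0: "0 \<le> E" using m \<Lambda> T A0 by (simp add: E_def)
  \<comment> \<open>The constant is \<open>9 * 6 * 48 * 72 * 12\<close>. The factor
    \<open>sqrt A\<close> in \<open>E\<close> and the one from the sum over \<open>a\<close> combine
    to \<open>A\<close>, which supplies the 12 and the power \<open>T^-3\<close>.\<close>
  have bd: "9 * B * E / Y^2 * (2 + 4 * sqrt A / Y) \<le> 2239488 * (m * \<Lambda> / (T * Y))^3"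
  proof -
    have "1 \<le> sqrt A / Y" using YA Y by simp
    then have "2 + 4 * (sqrt A / Y) \<le> 6 * (sqrt A / Y)" by simp
    then have "2 + 4 * sqrt A / Y \<le> 6 * (sqrt A / Y)" by simp
    then have "9 * B * E / Y^2 * (2 + 4 * sqrt A / Y) \<le> 9 * B * E / Y^2 * (6 * (sqrt A / Y))"
      using YB Y E0 by (intro mult_left_mono) auto
    also have "\<dots> = 3888 * B * m * \<Lambda> * T * (sqrt A * sqrt A) / Y^3"
      by (simp add: E_def power2_eq_square power3_eq_cube)
    also have "\<dots> = 3888 * B * m * \<Lambda> * T * A / Y^3" using A0 by simp
    also have "\<dots> = 2239488 * (m * \<Lambda> / (T * Y))^3"
      using T Y unfolding A_def B_def by (simp add: field_simps power2_eq_square power3_eq_cube)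
    finally show ?thesis .
  qed
  have ZP: "finite (Z P)" "real (card (Z P)) \<le> 2239488 * (m * \<Lambda> / (T * Y))^3" if "P \<in> prim_box Y" for P
  proof -
    obtain \<alpha> \<beta> where P: "P = (\<alpha>, \<beta>)" by (cases P)
    have P': "coprime \<alpha> \<beta>" "Y \<le> \<bar>of_int \<beta>\<bar>" using that by (auto simp: P prim_box_def)
    have Y1: "1 \<le> Y" using Y by simp
    show "finite (Z P)" unfolding Z_def P prod.case
      by (rule cusp_forms_card(1)[OF P'(1) Y1 P'(2) less_imp_le[OF A0] YB YE E0])
    show "real (card (Z P)) \<le> 2239488 * (m * \<Lambda> / (T * Y))^3" unfolding Z_def P prod.case
      by (rule order_trans[OF cusp_forms_card(2)[OF P'(1) Y1 P'(2) less_imp_le[OF A0] YB YE E0] bd])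
  qed
  have sub: "solution_pairs (gauss_cusp \<nu> T) v i cm cp X Y \<subseteq> (\<lambda>(P, f). (map_form real_of_int f, P)) ` Sigma (prim_box Y) Z"
  proof clarify
    fix fa fb fc fd \<alpha> \<beta> assume "((fa, fb, fc, fd), \<alpha>, \<beta>) \<in> solution_pairs (gauss_cusp \<nu> T) v i cm cp X Y"
    then have P: "(\<alpha>, \<beta>) \<in> prim_box Y" and orb: "(fa, fb, fc, fd) \<in> (\<lambda>g. act g v) ` gauss_cusp \<nu> T"
      and irr: "(fa, fb, fc, fd) \<in> V_Z_irr i" and ev: "form_eval (fa, fb, fc, fd) (of_int \<alpha>) (of_int \<beta>) = 1"
      and ds: "\<bar>Disc (fa, fb, fc, fd)\<bar> < cp * X" unfolding solution_pairs_def by auto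
    obtain h where h: "(fa, fb, fc, fd) = map_form real_of_int h" using irr unfolding V_Z_irr_def V_Z_def by blast
    obtain a b c d where abcd: "h = (a, b, c, d)" by (cases h)
    have f: "fa = of_int a" "fb = of_int b" "fc = of_int c" "fd = of_int d" using h by (simp_all add: abcd)
    have ev': "form_eval (a, b, c, d) \<alpha> \<beta> = 1"
      using ev unfolding h form_eval_map_form abcd by (simp only: of_int_eq_1_iff)
    \<comment> \<open>If \<open>a = 0\<close>, then \<open>\<beta>\<close> divides the value 1,
      although \<open>\<bar>\<beta>\<bar> \<ge> Y \<ge> 2\<close>.\<close>
    have a0: "a \<noteq> 0"
    proof
      assume "a = 0"
      then have "\<beta> * (b * \<alpha>^2 + c * \<alpha> * \<beta> + d * \<beta>^2) = 1"
        using ev' by (simp add: algebra_simps power2_eq_square power3_eq_cube)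
      then have "\<beta> dvd 1" by (metis dvd_triv_left)
      then have "\<bar>real_of_int \<beta>\<bar> = 1" by (metis of_int_1 of_int_abs zdvd1_eq)
      then show False using P Y by (simp add: prim_box_def)
    qed
    obtain t l where tl: "t > T" "t \<ge> t0" "l > 0" "Disc (fa, fb, fc, fd) = l^4 * Disc v"
      "\<bar>fa\<bar> \<le> 12 * m * l / t^3" "\<bar>fb\<bar> \<le> 48 * m * l / t" "\<bar>fc\<bar> \<le> 72 * m * l * t"
      by (rule cusp_coeffs[OF \<nu> orb v])
    \<comment> \<open>The upper bound on the discriminant turns into
      \<open>l \<le> \<Lambda>\<close>, so that \<open>\<Lambda>\<close> may replace
      \<open>l\<close> in all coefficient bounds.\<close>
    have "l^4 * \<bar>Disc v\<bar> \<le> \<Lambda>^4 * \<bar>Disc v\<bar>" using ds X tl(3) by (simp add: tl(4) abs_mult)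
    then have "l^4 \<le> \<Lambda>^4" using D by simp
    then have lL: "l \<le> \<Lambda>" using \<Lambda> by (metis less_imp_le power_mono_iff tl(3) zero_less_numeral)
    have t0: "t > 0" using tl T by simp
    have "\<bar>fa\<bar> \<le> 12 * m * \<Lambda> / t^3" using tl(5) by (rule order_trans) (use lL m t0 in \<open>auto intro!: divide_right_mono mult_left_mono\<close>)
    also have aA: "\<dots> \<le> A" unfolding A_def using m \<Lambda> T t0 tl(1) by (intro divide_left_mono power_mono mult_pos_pos) auto
    finally have A': "\<bar>fa\<bar> \<le> A" .
    have "\<bar>fb\<bar> \<le> 48 * m * \<Lambda> / t" using tl(6) by (rule order_trans) (use lL m t0 in \<open>auto intro!: divide_right_mono mult_left_mono\<close>)
    also have "\<dots> \<le> B" unfolding B_def using m \<Lambda> T t0 tl(1) by (intro divide_left_mono mult_pos_pos) auto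
    finally have B': "\<bar>fb\<bar> \<le> B" .
    have fa0: "\<bar>fa\<bar> > 0" using a0 by (simp add: f)
    have "(t * sqrt \<bar>fa\<bar>)^2 = t^2 * \<bar>fa\<bar>" by (simp add: power_mult_distrib)
    also have "\<dots> \<le> t^2 * (12 * m * \<Lambda> / t^3)" using \<open>\<bar>fa\<bar> \<le> 12 * m * \<Lambda> / t^3\<close> by (intro mult_left_mono) auto
    also have "\<dots> = 12 * m * \<Lambda> / t" using t0 by (simp add: power2_eq_square power3_eq_cube)
    also have "\<dots> \<le> 12 * m * \<Lambda> / T" using m \<Lambda> T t0 tl(1) by (intro divide_left_mono mult_pos_pos) auto
    also have "\<dots> = (T * sqrt A)^2" using T A0 by (simp add: power_mult_distrib) (simp add: A_def power2_eq_square power3_eq_cube)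
    finally have "t * sqrt \<bar>fa\<bar> \<le> T * sqrt A" by (rule power2_le_imp_le) (use T A0 in simp)
    then have ts: "t \<le> T * sqrt A / sqrt \<bar>fa\<bar>" using fa0 by (simp add: field_simps)
    have "\<bar>fc\<bar> \<le> 72 * m * \<Lambda> * t" using tl(7) by (rule order_trans) (use lL m t0 in \<open>auto intro!: mult_right_mono mult_left_mono\<close>)
    also have "\<dots> \<le> 72 * m * \<Lambda> * (T * sqrt A / sqrt \<bar>fa\<bar>)" using ts m \<Lambda> by (intro mult_left_mono) auto
    also have "\<dots> = E / sqrt \<bar>fa\<bar>" by (simp add: E_def)
    finally have "\<bar>fc\<bar> \<le> E / sqrt \<bar>fa\<bar>" .
    then have "(a, b, c, d) \<in> Z (\<alpha>, \<beta>)" using A' B' ev' a0 unfolding Z_def f by (simp del: form_eval.simps)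
    then show "((fa, fb, fc, fd), \<alpha>, \<beta>) \<in> (\<lambda>(P, f). (map_form real_of_int f, P)) ` Sigma (prim_box Y) Z"
      using P by (intro image_eqI[of _ _ "((\<alpha>, \<beta>), (a, b, c, d))"]) (simp_all add: f)
  qed
  have finS: "finite (Sigma (prim_box Y) Z)" using finite_prim_box ZP(1) by (intro finite_SigmaI)
  have "card (solution_pairs (gauss_cusp \<nu> T) v i cm cp X Y) \<le> card (Sigma (prim_box Y) Z)"
    by (rule surj_card_le[OF finS sub])
  also have "\<dots> = (\<Sum>P\<in>prim_box Y. card (Z P))" using finite_prim_box ZP(1) by (intro card_SigmaI) auto
  finally have "real (card (solution_pairs (gauss_cusp \<nu> T) v i cm cp X Y)) \<le> (\<Sum>P\<in>prim_box Y. real (card (Z P)))"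
    by (simp flip: of_nat_sum)
  also have "\<dots> \<le> real (card (prim_box Y)) * (2239488 * (m * \<Lambda> / (T * Y))^3)"
    using ZP(2) by (intro sum_bounded_above)
  finally show ?thesis using finS sub by (meson finite_imageI finite_subset)
qed

text \<open>Here \<open>x\<close> stands for the fourth root of the discriminant bound, and
  \<open>\<Lambda> = \<theta> * x\<close> because the discriminant scales with \<open>l^4\<close>.
  The order of quantifiers matters: \<open>K\<close> is independent of \<open>T\<close>, while the
  admissible range of \<open>Y\<close> may shrink with \<open>T\<close>.\<close>

lemma cusp_pairs_card:
  fixes v :: "real cubic_form"
  assumes \<nu>: "gauss_fibre \<nu>" and D: "Disc v \<noteq> 0" and cp: "0 < cp"
  obtains K where "0 < K"
    "\<forall>T>0. \<exists>c>0. \<forall>x Y. 2 \<le> Y \<longrightarrow> Y^2 \<le> c * x \<longrightarrow>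
      finite (solution_pairs (gauss_cusp \<nu> T) v i cm cp (x^4) Y) \<and>
      real (card (solution_pairs (gauss_cusp \<nu> T) v i cm cp (x^4) Y)) \<le> real (card (prim_box Y)) * (K / T^3 * (x / Y)^3)"
proof -
  obtain a b c d where v: "v = (a, b, c, d)" by (cases v)
  define m where "m = 1 + \<bar>a\<bar> + \<bar>b\<bar> + \<bar>c\<bar> + \<bar>d\<bar>"
  have m: "form_bounded m v" "m > 0" by (auto simp: v m_def)
  define \<theta> where "\<theta> = root 4 (cp / \<bar>Disc v\<bar>)"
  have \<theta>: "\<theta> > 0" "\<theta>^4 * \<bar>Disc v\<bar> = cp" using D cp by (simp_all add: \<theta>_def)
  have bound: "\<exists>c>0. \<forall>x Y. 2 \<le> Y \<longrightarrow> Y^2 \<le> c * x \<longrightarrow>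
      finite (solution_pairs (gauss_cusp \<nu> T) v i cm cp (x^4) Y) \<and>
      real (card (solution_pairs (gauss_cusp \<nu> T) v i cm cp (x^4) Y)) \<le>
        real (card (prim_box Y)) * (2239488 * (m * \<theta>)^3 / T^3 * (x / Y)^3)"
    if T: "0 < T" for T
  proof -
    \<comment> \<open>One condition on \<open>Y^2\<close> implies all three size conditions; the two
      that are linear in \<open>Y\<close> follow through \<open>Y \<le> Y^2\<close>.\<close>
    define c where "c = min (48 * m * \<theta> / T) (min (72 * m * \<theta> * T) (12 * m * \<theta> / T^3))"
    have "finite (solution_pairs (gauss_cusp \<nu> T) v i cm cp (x^4) Y) \<and>
      real (card (solution_pairs (gauss_cusp \<nu> T) v i cm cp (x^4) Y)) \<le> real (card (prim_box Y)) * (2239488 * (m * \<theta>)^3 / T^3 * (x / Y)^3)"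
      if Y: "2 \<le> Y" "Y^2 \<le> c * x" for x Y
    proof -
      have c0: "c > 0" using m \<theta> T by (simp add: c_def)
      have "0 < c * x" using Y by (smt (verit) zero_less_power)
      then have x: "x > 0" using c0 by (simp add: zero_less_mult_iff)
      have Y1: "Y \<le> Y^2" using Y(1) by (simp add: power2_eq_square)
      have 1: "Y^2 \<le> 48 * m * \<theta> / T * x" by (rule order_trans[OF Y(2)], intro mult_right_mono) (use x in \<open>simp_all add: c_def\<close>)
      have 2: "Y^2 \<le> 72 * m * \<theta> * T * x" by (rule order_trans[OF Y(2)], intro mult_right_mono) (use x in \<open>simp_all add: c_def\<close>)
      have 3: "Y^2 \<le> 12 * m * \<theta> / T^3 * x" by (rule order_trans[OF Y(2)], intro mult_right_mono) (use x in \<open>simp_all add: c_def\<close>)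
      have "Y \<le> 48 * m * \<theta> / T * x" using 1 Y1 by linarith
      then have e1: "Y * T \<le> 48 * m * (\<theta> * x)" using T by (simp add: field_simps)
      have e2: "Y \<le> 72 * m * (\<theta> * x) * T" using 2 Y1 by (simp add: mult_ac)
      have e3: "Y^2 \<le> 12 * m * (\<theta> * x) / T^3" using 3 by (simp add: mult_ac)
      have e4: "cp * x^4 \<le> (\<theta> * x)^4 * \<bar>Disc v\<bar>" using \<theta>(2) by (simp add: power_mult_distrib mult_ac flip: \<theta>(2))
      have e5: "2239488 * (m * (\<theta> * x) / (T * Y))^3 = 2239488 * (m * \<theta>)^3 / T^3 * (x / Y)^3"
        by (simp add: power_mult_distrib power_divide)
      show ?thesis
        using cusp_pairs_card_aux[OF \<nu> m(1) D m(2) _ T Y(1) e4 e1 e2 e3, of i cm] \<theta>(1) x unfolding e5 by simp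
    qed
    moreover have "c > 0" using m \<theta> T by (simp add: c_def)
    ultimately show ?thesis by blast
  qed
  show thesis
    by (rule that[of "2239488 * (m * \<theta>)^3"]) (use m \<theta> bound in simp_all)
qed

section \<open>Lower bound for the number of models\<close>

lemma gauss_domain_det: "g \<in> gauss_domain \<nu> \<Longrightarrow> det g \<noteq> 0"
proof -
  assume "g \<in> gauss_domain \<nu>"
  then obtain u t k l where g: "g = n_mat u ** a_mat t ** k ** mat l" "t \<ge> t0" "rotation_matrix k" "l > 0"
    unfolding gauss_domain_def by blast
  have "t \<noteq> 0" using g(2) t0_pos by linarith
  then show "det g \<noteq> 0" using g by (simp add: det_mul det_n_mat det_a_mat rotation_det det_mat_2)
qed

text \<open>It makes the finiteness proved for cusps available for the whole domain.\<close>

lemma gauss_domain_subset_cusp: "T < t0 \<Longrightarrow> gauss_domain \<nu> \<subseteq> gauss_cusp \<nu> T"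
  unfolding gauss_domain_def gauss_cusp_def by fastforce

lemma orbit_scale:
  assumes "(a, b, c, d) \<in> (\<lambda>g. act g v) ` gauss_domain \<nu>" "l > 0"
  shows "(l * a, l * b, l * c, l * d) \<in> (\<lambda>g. act g v) ` gauss_domain \<nu>"
proof -
  obtain g where g: "g \<in> gauss_domain \<nu>" "(a, b, c, d) = act g v" using assms(1) by blast
  have one: "rotation_matrix (mat 1 :: real^2^2)" by (simp add: rotation_matrix_def orthogonal_matrix_id)
  have "(l * a, l * b, l * c, l * d) = act (mat l ** g) v" using assms(2) by (simp add: act_mat act_mult flip: g(2))
  also have "mat l ** g = g ** mat l ** mat 1" by (simp add: mat_commute)
  finally show ?thesis using gauss_domain_mult[OF g(1) one assms(2)] by blast
qed

text \<open>The neighbourhoods from \<open>orbit_neighbourhood\<close> are dilated by a multiple of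
  \<open>x\<close>; each contains about \<open>(x / Y)^3\<close> odd solutions, and properness
  bounds how many of them share a model. Finiteness is assumed because \<open>card\<close> assigns 0
  to an infinite set.\<close>

lemma domain_models_card:
  fixes v :: "real cubic_form"
  assumes \<nu>: "gauss_fibre \<nu>" and v: "v \<in> V_R i" and cm: "0 < cm" "cm < cp"
  obtains \<eta> K where "0 < \<eta>" "0 < K"
    "\<forall>x Y. 2 \<le> Y \<longrightarrow> Y \<le> \<eta> * x \<longrightarrow> finite (solution_pairs (gauss_domain \<nu>) v i cm cp (x^4) Y) \<longrightarrow>
      real (card (prim_box Y)) * (K * (x / Y)^3) \<le> real (model_count (gauss_domain \<nu>) v i cm cp (x^4) Y)"
proof -
  define D where "D = \<bar>Disc v\<bar>"
  have Dv: "Disc v \<noteq> 0" using v by (auto simp: V_R_def split: if_splits)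
  then have D0: "D > 0" by (simp add: D_def)
  \<comment> \<open>Aiming at discriminant \<open>c * x^4\<close>, strictly between the two limits,
    leaves room on both sides. \<open>\<kappa>1\<close> and \<open>\<kappa>2\<close> are those
    limits scaled back to the undilated forms.\<close>
  define c where "c = (cm + cp) / 2"
  have c: "cm < c" "c < cp" "0 < c" using cm by (auto simp: c_def)
  define \<kappa>1 where "\<kappa>1 = cm * D / c"
  define \<kappa>2 where "\<kappa>2 = cp * D / c"
  have \<kappa>: "\<kappa>1 < \<bar>Disc v\<bar>" "\<bar>Disc v\<bar> < \<kappa>2" "0 < \<kappa>1"
    using c D0 cm by (simp_all add: \<kappa>1_def \<kappa>2_def field_simps flip: D_def)
  obtain \<epsilon> m where \<epsilon>: "\<epsilon> > 0" and nb:
    "\<forall>\<alpha> \<beta>. \<alpha> \<noteq> 0 \<longrightarrow> (\<exists>f0. form_eval f0 \<alpha> \<beta> = 0 \<and> form_bounded m f0 \<and>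
      (\<forall>f. dist f f0 < \<epsilon> \<longrightarrow> f \<in> (\<lambda>g. act g v) ` gauss_domain \<nu> \<and> \<kappa>1 < \<bar>Disc f\<bar> \<and> \<bar>Disc f\<bar> < \<kappa>2))"
    by (rule orbit_neighbourhood[OF \<nu> Dv \<kappa>(1,2)])
  define \<theta> where "\<theta> = root 4 (c / D)"
  have \<theta>: "\<theta> > 0" "\<theta>^4 = c / D" using c D0 by (simp_all add: \<theta>_def)
  define m' where "m' = m + \<epsilon>"
  \<comment> \<open>Dilation by \<open>l\<close> multiplies both sides of the properness condition
    by \<open>l^4\<close>, so \<open>b\<close> can be chosen independently of \<open>x\<close>. The
    added 1 ensures \<open>b \<ge> 1\<close>, whence \<open>b \<le> b^2\<close>.\<close>
  obtain b :: nat where "54 * (12 * m')^4 / \<kappa>1 + 1 \<le> b" using real_arch_simple by blast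
  moreover have "0 \<le> 54 * (12 * m')^4 / \<kappa>1" using \<kappa>(3) by simp
  ultimately have "54 * (12 * m')^4 / \<kappa>1 \<le> b" "1 \<le> real b" by linarith+
  then have "54 * (12 * m')^4 / \<kappa>1 \<le> (real b)^2" by (smt (verit) self_le_power zero_less_numeral)
  then have b: "54 * (12 * m')^4 \<le> (real b)^2 * \<kappa>1" using \<kappa>(3) by (simp add: field_simps)
  define K where "K = (\<epsilon> * \<theta> / 600)^3 / real ((2 * b + 1)^4)"
  show thesis
  proof (rule that[of "\<epsilon> * \<theta> / 300" K])
    show "0 < \<epsilon> * \<theta> / 300" "0 < K" using \<epsilon> \<theta> by (simp_all add: K_def)
  next
    show "\<forall>x Y. 2 \<le> Y \<longrightarrow> Y \<le> \<epsilon> * \<theta> / 300 * x \<longrightarrow> finite (solution_pairs (gauss_domain \<nu>) v i cm cp (x^4) Y) \<longrightarrow>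
      real (card (prim_box Y)) * (K * (x / Y)^3) \<le> real (model_count (gauss_domain \<nu>) v i cm cp (x^4) Y)"
    proof (intro allI impI)
      fix x Y assume Y: "2 \<le> Y" "Y \<le> \<epsilon> * \<theta> / 300 * x" and fin: "finite (solution_pairs (gauss_domain \<nu>) v i cm cp (x^4) Y)"
      define l where "l = \<theta> * x"
      have "0 < \<epsilon> * \<theta> / 300 * x" using Y by linarith
      then have x: "x > 0" by (rule zero_less_mult_pos) (use \<epsilon> \<theta> in simp)
      have l: "l > 0" "l^4 = c / D * x^4" using \<theta> x by (simp_all add: l_def power_mult_distrib)
      have l\<kappa>: "l^4 * \<kappa>1 = cm * x^4" "l^4 * \<kappa>2 = cp * x^4" using c D0 by (simp_all add: l \<kappa>1_def \<kappa>2_def)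
      \<comment> \<open>With \<open>N \<le> z\<close> each coefficient is off by at most
        \<open>\<epsilon> * l / 5\<close>, so four of them stay below \<open>\<epsilon>\<close>
        after rescaling. The condition on \<open>Y\<close> gives \<open>z \<ge> 1\<close>, so
        rounding down loses at most a factor 2.\<close>
      define z where "z = \<epsilon> * l / (300 * Y)"
      have z1: "1 \<le> z" using Y by (simp add: z_def l_def field_simps)
      define N where "N = nat \<lfloor>z\<rfloor>"
      have "1 \<le> \<lfloor>z\<rfloor>" using z1 by simp
      then have "real N = of_int \<lfloor>z\<rfloor>" "1 \<le> real_of_int \<lfloor>z\<rfloor>" by (simp_all add: N_def)
      then have N: "real N \<le> z" "z / 2 \<le> real N" by linarith+
      have NY: "60 * Y * N \<le> \<epsilon> * l / 5"
      proof -
        have "60 * Y * N \<le> 60 * Y * z" using N Y by (intro mult_left_mono) auto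
        also have "\<dots> = \<epsilon> * l / 5" using Y by (simp add: z_def)
        finally show ?thesis .
      qed
      define good where "good = (\<lambda>f. f \<in> (\<lambda>g. act g v) ` gauss_domain \<nu> \<and> f \<in> V_Z_irr i \<and> form_bounded (m' * l) f
         \<and> cm * x^4 < \<bar>Disc f\<bar> \<and> \<bar>Disc f\<bar> < cp * x^4)"
      have "\<exists>W. finite W \<and> card W = N^3 \<and> (\<forall>h\<in>W. form_eval h (fst P) (snd P) = 1 \<and> good (map_form real_of_int h))"
        if P: "P \<in> prim_box Y" for P
      proof -
        obtain \<alpha> \<beta> where P': "P = (\<alpha>, \<beta>)" by (cases P)
        have box: "coprime \<alpha> \<beta>" "Y \<le> \<bar>of_int \<alpha>\<bar>" "\<bar>of_int \<alpha>\<bar> < 2 * Y" "Y \<le> \<bar>of_int \<beta>\<bar>" "\<bar>of_int \<beta>\<bar> < 2 * Y"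
          using P by (auto simp: P' prim_box_def)
        have \<alpha>0: "real_of_int \<alpha> \<noteq> 0" using box Y by auto
        obtain f0 where f0: "form_eval f0 (of_int \<alpha>) (of_int \<beta>) = 0" "form_bounded m f0"
          and near: "\<And>f. dist f f0 < \<epsilon> \<Longrightarrow> f \<in> (\<lambda>g. act g v) ` gauss_domain \<nu> \<and> \<kappa>1 < \<bar>Disc f\<bar> \<and> \<bar>Disc f\<bar> < \<kappa>2"
          using nb \<alpha>0 by blast
        obtain a0 b0 c0 d0 where f0': "f0 = (a0, b0, c0, d0)" by (cases f0)
        have "form_eval (l * a0, l * b0, l * c0, l * d0) (of_int \<alpha>) (of_int \<beta>) = l * form_eval f0 (of_int \<alpha>) (of_int \<beta>)"
          by (simp add: f0' algebra_simps)
        then have rt: "form_eval (l * a0, l * b0, l * c0, l * d0) (of_int \<alpha>) (of_int \<beta>) = 0" by (simp only: f0 mult_zero_right)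
        define Z where "Z = {(a, b, c, d). form_eval (a, b, c, d) \<alpha> \<beta> = 1 \<and> odd a \<and> odd d \<and> odd (b + c) \<and>
          \<bar>of_int a - l * a0\<bar> \<le> 60 * Y * N \<and> \<bar>of_int b - l * b0\<bar> \<le> 60 * Y * N \<and> \<bar>of_int c - l * c0\<bar> \<le> 60 * Y * N \<and> \<bar>of_int d - l * d0\<bar> \<le> 60 * Y * N}"
        have Y1: "1 \<le> Y" using Y by simp
        obtain W where W: "W \<subseteq> Z" "finite W" "card W = N^3"
          using odd_forms_card[OF box(1) Y1 box(2-5) rt, of N] unfolding Z_def by blast
        have "form_eval h \<alpha> \<beta> = 1 \<and> good (map_form real_of_int h)" if "h \<in> W" for h
        proof -
          obtain a b c d where h: "h = (a, b, c, d)" by (cases h)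
          have hZ: "form_eval h \<alpha> \<beta> = 1" "odd a" "odd d" "odd (b + c)" "\<bar>of_int a - l * a0\<bar> \<le> \<epsilon> * l / 5"
            "\<bar>of_int b - l * b0\<bar> \<le> \<epsilon> * l / 5" "\<bar>of_int c - l * c0\<bar> \<le> \<epsilon> * l / 5" "\<bar>of_int d - l * d0\<bar> \<le> \<epsilon> * l / 5"
            using that W(1) NY unfolding h Z_def by (auto simp del: form_eval.simps)
          have dv: "\<bar>w / l - w0\<bar> \<le> \<epsilon> / 5" if "\<bar>w - l * w0\<bar> \<le> \<epsilon> * l / 5" for w w0
          proof -
            have "w / l - w0 = (w - l * w0) / l" using l by (simp add: field_simps)
            then show ?thesis using that l by (simp add: abs_divide field_simps)
          qed
          define f where "f = map_form real_of_int h"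
          define f' where "f' = (of_int a / l, of_int b / l, of_int c / l, of_int d / l)"
          have "dist f' f0 = norm (of_int a / l - a0, of_int b / l - b0, of_int c / l - c0, of_int d / l - d0)"
            by (simp add: f'_def f0' dist_norm)
          also have "\<dots> \<le> \<bar>of_int a / l - a0\<bar> + (\<bar>of_int b / l - b0\<bar> + (\<bar>of_int c / l - c0\<bar> + \<bar>of_int d / l - d0\<bar>))"
            using norm_Pair_le[of "of_int a / l - a0" "(of_int b / l - b0, of_int c / l - c0, of_int d / l - d0)"]
              norm_Pair_le[of "of_int b / l - b0" "(of_int c / l - c0, of_int d / l - d0)"]
              norm_Pair_le[of "of_int c / l - c0" "of_int d / l - d0"] by simp
          also have "\<dots> < \<epsilon>" using dv[OF hZ(5)] dv[OF hZ(6)] dv[OF hZ(7)] dv[OF hZ(8)] \<epsilon> by linarith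
          finally have f': "f' \<in> (\<lambda>g. act g v) ` gauss_domain \<nu>" "\<kappa>1 < \<bar>Disc f'\<bar>" "\<bar>Disc f'\<bar> < \<kappa>2" using near by auto
          have f: "f = (of_int a, of_int b, of_int c, of_int d)" by (simp add: f_def h)
          have orb: "f \<in> (\<lambda>g. act g v) ` gauss_domain \<nu>"
            using orbit_scale[OF f'(1)[unfolded f'_def] l(1)] l(1) by (simp add: f)
          have "Disc f = l^4 * Disc f'" using Disc_map_form_divide[of l f] l(1) by (simp add: f f'_def)
          then have ad: "\<bar>Disc f\<bar> = l^4 * \<bar>Disc f'\<bar>" by (simp add: abs_mult)
          have "l^4 * \<kappa>1 < \<bar>Disc f\<bar>" "\<bar>Disc f\<bar> < l^4 * \<kappa>2" unfolding ad using f' l(1) by simp_all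
          then have ds: "cm * x^4 < \<bar>Disc f\<bar>" "\<bar>Disc f\<bar> < cp * x^4" unfolding l\<kappa> by simp_all
          obtain g where g: "g \<in> gauss_domain \<nu>" "f = act g v" using orb by blast
          \<comment> \<open>The discriminant changes by a positive factor only, so the form has the
            same sign type as \<open>v\<close>.\<close>
          have "Disc f = (det g)^2 * Disc v" unfolding g by (rule Disc_act[OF gauss_domain_det[OF g(1)]])
          then have "f \<in> V_R i" using v gauss_domain_det[OF g(1)] by (auto simp: V_R_def zero_less_mult_iff mult_less_0_iff split: if_splits)
          moreover have "f = map_form real_of_rat (map_form rat_of_int h)" by (simp add: f h)
          ultimately have irr: "f \<in> V_Z_irr i" using odd_form_irreducible[OF hZ(2-4)] unfolding V_Z_irr_def V_Z_def f_def h by blast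
          have bd: "\<bar>w\<bar> \<le> m' * l" if "\<bar>w - l * w0\<bar> \<le> \<epsilon> * l / 5" "\<bar>w0\<bar> \<le> m" for w w0
          proof -
            have "\<bar>l * w0\<bar> \<le> l * m" unfolding abs_mult using that l by (simp add: mult_left_mono)
            moreover have "\<epsilon> * l / 5 \<le> \<epsilon> * l" using \<epsilon> l by simp
            moreover have "m' * l = l * m + \<epsilon> * l" by (simp add: m'_def algebra_simps)
            ultimately show ?thesis using that(1) by linarith
          qed
          have "form_bounded (m' * l) f" using f0(2) bd[OF hZ(5)] bd[OF hZ(6)] bd[OF hZ(7)] bd[OF hZ(8)] by (simp add: f f0')
          then show ?thesis using hZ(1) orb irr ds unfolding good_def f_def by simp
        qed
        then show ?thesis using W(2,3) by (auto simp: P' simp del: form_eval.simps)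
      qed
      then obtain W where W: "\<And>P. P \<in> prim_box Y \<Longrightarrow> finite (W P)" "\<And>P. P \<in> prim_box Y \<Longrightarrow> card (W P) = N^3"
        "\<And>P h. P \<in> prim_box Y \<Longrightarrow> h \<in> W P \<Longrightarrow> form_eval h (fst P) (snd P) = 1 \<and> good (map_form real_of_int h)"
        by metis
      define S where "S = (\<lambda>(P, h). (map_form real_of_int h, P)) ` Sigma (prim_box Y) W"
      have "inj_on (\<lambda>(P, h). (map_form real_of_int h, P)) (Sigma (prim_box Y) W)"
        by (rule inj_onI) (auto split: prod.splits)
      then have "card S = card (Sigma (prim_box Y) W)" unfolding S_def by (rule card_image)
      also have "\<dots> = card (prim_box Y) * N^3" using W(1,2) finite_prim_box by simp
      finally have cardS: "card S = card (prim_box Y) * N^3" .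
      have S: "integral_solution f P \<and> good f \<and> P \<in> prim_box Y \<and> form_eval f (of_int (fst P)) (of_int (snd P)) = 1" if fP: "(f, P) \<in> S" for f P
      proof -
        obtain h where h: "P \<in> prim_box Y" "h \<in> W P" "f = map_form real_of_int h"
          using fP unfolding S_def by (elim imageE SigmaE) (metis case_prod_conv prod.inject)
        moreover have "form_eval f (of_int (fst P)) (of_int (snd P)) = 1"
          unfolding h(3) form_eval_map_form using W(3)[OF h(1,2)] by simp
        ultimately show ?thesis using W(3)[OF h(1,2)] by (auto simp: integral_solution_def prim_box_def simp del: form_eval.simps)
      qed
      have finS: "finite S" unfolding S_def using W(1) finite_prim_box by (intro finite_imageI finite_SigmaI)
      have "card S \<le> (2 * b + 1)^4 * card ((\<lambda>(f, P). weierstrass_model f P) ` S)"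
      proof (rule card_solutions_le_models[OF finS, where m = "m' * l"])
        fix f P assume fP: "(f, P) \<in> S"
        show "integral_solution f P" "form_bounded (m' * l) f" using S[OF fP] by (simp_all add: good_def)
        have "l^4 * \<kappa>1 \<le> \<bar>Disc f\<bar>" using S[OF fP] unfolding l\<kappa> by (simp add: good_def)
        moreover have "0 < l^4 * \<kappa>1" using l(1) \<kappa>(3) by simp
        moreover have "54 * (12 * (m' * l))^4 = 54 * (12 * m')^4 * l^4" by (simp add: power_mult_distrib)
        moreover have "\<dots> \<le> (real b)^2 * \<kappa>1 * l^4" using b by (intro mult_right_mono) auto
        moreover have "(real b)^2 * (l^4 * \<kappa>1) \<le> (real b)^2 * \<bar>Disc f\<bar>" using calculation(1) by (intro mult_left_mono) auto
        ultimately show "54 * (12 * (m' * l))^4 \<le> (of_nat b)^2 * \<bar>Disc f\<bar> \<and> Disc f \<noteq> 0" by (auto simp: mult_ac)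
      qed
      also have "card ((\<lambda>(f, P). weierstrass_model f P) ` S) \<le> model_count (gauss_domain \<nu>) v i cm cp (x^4) Y"
        unfolding model_count_def
      proof (intro card_mono image_mono finite_imageI fin subsetI)
        fix s assume "s \<in> S"
        then show "s \<in> solution_pairs (gauss_domain \<nu>) v i cm cp (x^4) Y"
          using S[of "fst s" "snd s"] by (auto simp: solution_pairs_def good_def split_beta simp del: form_eval.simps)
      qed
      finally have le: "card (prim_box Y) * N^3 \<le> (2 * b + 1)^4 * model_count (gauss_domain \<nu>) v i cm cp (x^4) Y"
        by (simp add: cardS)
      have "(z / 2)^3 \<le> real N ^ 3" using N z1 by (intro power_mono) auto
      then have "real (card (prim_box Y)) * (z / 2)^3 \<le> real (card (prim_box Y)) * real N ^ 3" by (intro mult_left_mono) auto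
      also have "\<dots> = real (card (prim_box Y) * N^3)" by simp
      also have "\<dots> \<le> real ((2 * b + 1)^4 * model_count (gauss_domain \<nu>) v i cm cp (x^4) Y)" using le by (simp only: of_nat_le_iff)
      also have "\<dots> = real ((2 * b + 1)^4) * real (model_count (gauss_domain \<nu>) v i cm cp (x^4) Y)" by (rule of_nat_mult)
      finally have fin_le: "real (card (prim_box Y)) * (z / 2)^3 / real ((2 * b + 1)^4) \<le> real (model_count (gauss_domain \<nu>) v i cm cp (x^4) Y)"
        by (subst pos_divide_le_eq) (simp_all add: mult.commute)
      have zz: "z / 2 = \<epsilon> * \<theta> / 600 * (x / Y)" by (simp add: z_def l_def)
      have "(z / 2)^3 / real ((2 * b + 1)^4) = K * (x / Y)^3"
        unfolding zz K_def power_mult_distrib[of "\<epsilon> * \<theta> / 600"] by (rule times_divide_eq_left[symmetric])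
      then show "real (card (prim_box Y)) * (K * (x / Y)^3) \<le> real (model_count (gauss_domain \<nu>) v i cm cp (x^4) Y)"
        using fin_le by (metis times_divide_eq_right)
    qed
  qed
qed

theorem theorem43:
  fixes \<delta> cm cp :: real and i :: nat and v :: "real cubic_form"
    and \<nu> :: "real \<Rightarrow> real set" and Y :: "real \<Rightarrow> real"
  assumes "0 < \<delta>" and "\<delta> < 1/12"
    and "i \<in> {0, 1}"
    and "0 < cm" and "cm < cp"
    and "gauss_fibre \<nu>"
    and "v \<in> V_R i" and "shape v = \<i>"
    and "\<forall>\<^sub>F X in at_top. 2 \<le> Y X \<and> Y X \<le> X powr (1/12 - \<delta>)"
  shows "((\<lambda>T. Limsup at_top (\<lambda>X. ereal
            (real (model_count (gauss_cusp \<nu> T) v i cm cp X (Y X)) /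
             real (model_count (gauss_domain \<nu>) v i cm cp X (Y X)))))
          \<longlongrightarrow> 0) at_top"
proof -
  have Dv: "Disc v \<noteq> 0" using assms(7) by (auto simp: V_R_def split: if_splits)
  have cp: "0 < cp" using assms by simp
  obtain K1 where K1: "0 < K1" and upper: "\<forall>T>0. \<exists>c>0. \<forall>x Y. 2 \<le> Y \<longrightarrow> Y^2 \<le> c * x \<longrightarrow>
      finite (solution_pairs (gauss_cusp \<nu> T) v i cm cp (x^4) Y) \<and>
      real (card (solution_pairs (gauss_cusp \<nu> T) v i cm cp (x^4) Y)) \<le> real (card (prim_box Y)) * (K1 / T^3 * (x / Y)^3)"
    by (rule cusp_pairs_card[OF assms(6) Dv cp, of i cm])
  obtain \<eta> K2 where \<eta>: "0 < \<eta>" and K2: "0 < K2" and lower: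
    "\<forall>x Y. 2 \<le> Y \<longrightarrow> Y \<le> \<eta> * x \<longrightarrow> finite (solution_pairs (gauss_domain \<nu>) v i cm cp (x^4) Y) \<longrightarrow>
      real (card (prim_box Y)) * (K2 * (x / Y)^3) \<le> real (model_count (gauss_domain \<nu>) v i cm cp (x^4) Y)"
    by (rule domain_models_card[OF assms(6,7,4,5)])
  \<comment> \<open>From \<open>Y \<le> X^{1/12}\<close> it follows that
    \<open>Y^2 \<le> X^{1/6}\<close>, which is eventually below any fixed multiple of
    \<open>X^{1/4}\<close>. This serves both counting results for each fixed
    \<open>T\<close>.\<close>
  have small: "\<forall>\<^sub>F X in at_top. 2 \<le> Y X \<and> (Y X)^2 \<le> c * X powr (1/4) \<and> 0 < X" if c: "c > 0" for c
  proof -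
    have "((\<lambda>X::real. X powr (1/6 - 1/4)) \<longlongrightarrow> 0) at_top" by (rule tendsto_neg_powr) (simp_all add: filterlim_ident)
    then have "\<forall>\<^sub>F X::real in at_top. X powr (1/6 - 1/4) < c" using c by (rule order_tendstoD)
    then show ?thesis using assms(9) eventually_ge_at_top[of 1]
    proof eventually_elim
      case (elim X)
      have "Y X \<le> X powr (1/12)" using elim assms(1) by (smt (verit) powr_mono)
      then have "(Y X)^2 \<le> (X powr (1/12))^2" using elim by (intro power_mono) auto
      also have "\<dots> = X powr (1/6 - 1/4) * X powr (1/4)"
        using elim by (simp add: powr_add[symmetric] powr_powr flip: powr_numeral)
      also have "\<dots> \<le> c * X powr (1/4)" using elim by (intro mult_right_mono) auto
      finally show ?case using elim by simp
    qed
  qed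
  \<comment> \<open>The value \<open>1/2\<close> lies below \<open>t0\<close>, so the cusp at height
    \<open>1/2\<close> contains the whole domain and supplies finiteness there.\<close>
  have half: "1/2 < t0"
  proof (rule ccontr)
    assume "\<not> ?thesis"
    then have "t0^4 \<le> (1/2)^4" using t0_pos by (intro power_mono) auto
    then show False by (simp add: t0_pow4 power_divide)
  qed
  obtain c0 where c0: "c0 > 0" and fin0: "\<And>x Y. 2 \<le> Y \<Longrightarrow> Y^2 \<le> c0 * x \<Longrightarrow> finite (solution_pairs (gauss_cusp \<nu> (1/2)) v i cm cp (x^4) Y)"
    using upper[rule_format, of "1/2"] by auto
  define R where "R = (\<lambda>T X. real (model_count (gauss_cusp \<nu> T) v i cm cp X (Y X)) /
             real (model_count (gauss_domain \<nu>) v i cm cp X (Y X)))"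
  \<comment> \<open>Both estimates contain the size of the box times \<open>(x / Y)^3\<close>; only
    \<open>K1 / K2\<close> and the decay \<open>T^-3\<close> survive in the quotient.\<close>
  have bound: "Limsup at_top (\<lambda>X. ereal (R T X)) \<le> ereal (K1 / K2 / T^3)" if T: "T > 0" for T
  proof (rule Limsup_bounded)
    obtain c where c: "c > 0" and up: "\<And>x Y. 2 \<le> Y \<Longrightarrow> Y^2 \<le> c * x \<Longrightarrow> finite (solution_pairs (gauss_cusp \<nu> T) v i cm cp (x^4) Y) \<and>
      real (card (solution_pairs (gauss_cusp \<nu> T) v i cm cp (x^4) Y)) \<le> real (card (prim_box Y)) * (K1 / T^3 * (x / Y)^3)"
      using upper[rule_format, OF T] by auto
    have "min c (min c0 \<eta>) > 0" using c c0 \<eta> by simp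
    from small[OF this] show "\<forall>\<^sub>F X in at_top. ereal (R T X) \<le> ereal (K1 / K2 / T^3)"
    proof eventually_elim
      case (elim X)
      define x where "x = X powr (1/4)"
      have x: "x > 0" "x^4 = X" using elim by (simp_all add: x_def powr_powr flip: powr_numeral)
      have Y: "2 \<le> Y X" "(Y X)^2 \<le> min c (min c0 \<eta>) * x" using elim by (simp_all add: x_def)
      have mul: "(Y X)^2 \<le> w * x" if "min c (min c0 \<eta>) \<le> w" for w
        using Y(2) mult_right_mono[OF that less_imp_le[OF x(1)]] by linarith
      have Yc: "(Y X)^2 \<le> c * x" "(Y X)^2 \<le> c0 * x" "(Y X)^2 \<le> \<eta> * x" by (rule mul, simp)+
      have "Y X \<le> (Y X)^2" using Y(1) by (simp add: power2_eq_square)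
      then have Y\<eta>: "Y X \<le> \<eta> * x" using Yc(3) by linarith
      have "solution_pairs (gauss_domain \<nu>) v i cm cp (x^4) (Y X) \<subseteq> solution_pairs (gauss_cusp \<nu> (1/2)) v i cm cp (x^4) (Y X)"
        using gauss_domain_subset_cusp[OF half, of \<nu>] unfolding solution_pairs_def by blast
      then have "finite (solution_pairs (gauss_domain \<nu>) v i cm cp (x^4) (Y X))" using fin0[OF Y(1) Yc(2)] by (rule finite_subset)
      note lo = lower[rule_format, OF Y(1) Y\<eta> this]
      note hi = up[OF Y(1) Yc(1)]
      have "real (model_count (gauss_cusp \<nu> T) v i cm cp (x^4) (Y X)) \<le> real (card (solution_pairs (gauss_cusp \<nu> T) v i cm cp (x^4) (Y X)))"
        unfolding model_count_def using hi by (simp add: card_image_le)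
      also have "\<dots> \<le> real (card (prim_box (Y X))) * (K1 / T^3 * (x / Y X)^3)" using hi by simp
      also have "\<dots> = K1 / K2 / T^3 * (real (card (prim_box (Y X))) * (K2 * (x / Y X)^3))" using K2 by simp
      also have "\<dots> \<le> K1 / K2 / T^3 * real (model_count (gauss_domain \<nu>) v i cm cp (x^4) (Y X))"
        using lo K1 K2 T by (intro mult_left_mono) auto
      \<comment> \<open>A vanishing denominator does no harm, since the quotient is then 0 by
        convention.\<close>
      finally have "R T X \<le> K1 / K2 / T^3"
        unfolding R_def x(2) using K1 K2 T by (simp add: divide_le_eq)
      then show ?case by simp
    qed
  qed
  have nonneg: "0 \<le> Limsup at_top (\<lambda>X. ereal (R T X))" for T
    by (rule le_Limsup) (simp_all add: R_def)
  have "((\<lambda>T::real. K1 / K2 / T^3) \<longlongrightarrow> 0) at_top"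
    by (intro tendsto_divide_0[OF tendsto_const] filterlim_at_top_imp_at_infinity filterlim_pow_at_top filterlim_ident) auto
  then have lim: "((\<lambda>T. ereal (K1 / K2 / T^3)) \<longlongrightarrow> 0) at_top" by (simp add: zero_ereal_def)
  have "((\<lambda>T. Limsup at_top (\<lambda>X. ereal (R T X))) \<longlongrightarrow> 0) at_top"
  proof (rule tendsto_sandwich[OF _ _ tendsto_const lim])
    show "\<forall>\<^sub>F T in at_top. 0 \<le> Limsup at_top (\<lambda>X. ereal (R T X))" using nonneg by simp
    show "\<forall>\<^sub>F T in at_top. Limsup at_top (\<lambda>X. ereal (R T X)) \<le> ereal (K1 / K2 / T^3)"
      using eventually_gt_at_top[of 0] by eventually_elim (rule bound)
  qed
  then show ?thesis unfolding R_def .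
qed

end
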